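(* Let $p<q$ be square-free integers $\ge 2$ with $p\equiv 2$ or $3\pmod 4$ and $q\equiv 1\pmod 4$, put $r=pq/\gcd(p,q)^2$ and assume $p<q<r$. Let $K=\mathbb{Q}(\sqrt p,\sqrt q)$. Let $m,\kappa,t$ be positive integers. Let $$I_2=\left[\frac{m\kappa}{4t}+\frac{\sqrt m}{\sqrt{2t}},\ \frac{m\kappa}{4(t-1)}-\frac{\sqrt m}{\sqrt{2(t-1)}}\right]\quad(t>1),$$ $$I_3=\left[\frac{m\kappa}{t}+\frac{2\sqrt m}{\sqrt t},\ \frac{m\kappa}{t-2}-\frac{2\sqrt m}{\sqrt{t-2}}\right]\quad(t>2),$$ where the right endpoint of $I_2$ is replaced by $\infty$ when $t=1$, and the right endpoint of $I_3$ is replaced by $\infty$ when $t\in\{1,2\}$. If $m\le\min\{\frac{r}{2\lceil\kappa\sqrt r\rceil},\,p,\,\frac q2\}$, $m\kappa\equiv t\pmod 2$, $\sqrt p\in I_2$ and $\sqrt q\in I_3$, then not all elements of $m\mathcal{O}_K^+$ are sums of squares of elements of $\mathcal{O}_K$. Moreover, these intervals are non-empty for $m\ge\frac{8t(t-1)\left(2t-1+2\sqrt{t(t-1)}\right)}{\kappa^2}$.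
   Context: $\mathcal{O}_K$ is the ring of integers of $K$, $\mathcal{O}_K^+$ is the set of its totally positive elements (all four real embeddings positive), and $m\mathcal{O}_K^+=\{m\alpha:\alpha\in\mathcal{O}_K^+\}$. A sum of squares in $\mathcal{O}_K$ is a finite sum $\sum_i\alpha_i^2$ with $\alpha_i\in\mathcal{O}_K$. *)

theory Defs
  imports
    Complex_Main
    "HOL-Computational_Algebra.Squarefree"
    "HOL-Number_Theory.Cong"
    "HOL-Algebra.Generated_Fields"
    "HOL-Algebra.Algebraic_Closure_Type"
begin

abbreviation real_ring :: "real ring" where
  "real_ring \<equiv> ring_of_type_algebra"

text \<open>
  A field is represented by its carrier inside \<open>\<real>\<close>.  A generated subfield of \<open>\<real>\<close>
  contains \<open>\<rat>\<close> automatically, so the following is \<open>\<rat>(\<surd>p, \<surd>q)\<close>.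
\<close>

definition biquadratic_field :: "nat \<Rightarrow> nat \<Rightarrow> real set" where
  "biquadratic_field p q = generate_field real_ring {sqrt (real p), sqrt (real q)}"

definition ring_of_integers :: "real set \<Rightarrow> real set" where
  "ring_of_integers K = {x \<in> K. algebraic_int x}"

text \<open>The values of an embedding outside \<open>K\<close> are unconstrained and irrelevant.\<close>

definition real_embeddings :: "real set \<Rightarrow> (real \<Rightarrow> real) set" where
  "real_embeddings K = ring_hom (real_ring\<lparr>carrier := K\<rparr>) real_ring"

definition totally_positive_integers :: "real set \<Rightarrow> real set" where
  "totally_positive_integers K =
     {x \<in> ring_of_integers K. \<forall>\<sigma> \<in> real_embeddings K. \<sigma> x > 0}"

definition sums_of_squares :: "real set \<Rightarrow> real set" where
  "sums_of_squares A = {(\<Sum>i<n. (\<alpha> i)\<^sup>2) | (n :: nat) \<alpha>. \<forall>i<n. \<alpha> i \<in> A}"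

definition I2 :: "nat \<Rightarrow> nat \<Rightarrow> nat \<Rightarrow> real set" where
  "I2 m \<kappa> t =
     (let a = real m * real \<kappa> / (4 * real t) + sqrt (real m) / sqrt (2 * real t);
          b = real m * real \<kappa> / (4 * (real t - 1)) - sqrt (real m) / sqrt (2 * (real t - 1))
      in if t = 1 then {a..} else {a..b})"

definition I3 :: "nat \<Rightarrow> nat \<Rightarrow> nat \<Rightarrow> real set" where
  "I3 m \<kappa> t =
     (let a = real m * real \<kappa> / real t + 2 * sqrt (real m) / sqrt (real t);
          b = real m * real \<kappa> / (real t - 2) - 2 * sqrt (real m) / sqrt (real t - 2)
      in if t \<in> {1, 2} then {a..} else {a..b})"

end

(*
  Write s = sqrt q and let alpha = k + kappa (1 + s)/2, where k is the least integer making alpha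
  totally positive; its conjugate under s |-> -s lies in (0, 1).  Suppose that m alpha is the sum of
  the squares of the integers (A_i + B_i sqrt p + C_i s + D_i sqrt r)/2.  Comparing coordinates gives
  sum (A_i C_i + (p/g) B_i D_i) = m kappa, and the conjugate equation gives
  sum ((A_i - C_i s)^2 + (B_i sqrt p - D_i sqrt r)^2) < 4 m.

  If some D_i is nonzero, then the trace of m alpha is large compared with sqrt r, and together with
  m <= r/(2 kappa sqrt r) this forces r < 16 m and m kappa^2 < 4; then t = 1 because I2 is nonempty,
  and the few remaining cases are excluded by I3.  If all D_i vanish, then A_i = C_i (mod 2), so that
  N = sum C_i^2 = m kappa = t (mod 2), while Cauchy--Schwarz gives |m kappa - N s| < 2 sqrt (m N).
  Since s lies in I3, this places N strictly between t - 2 and t, contradicting the parity.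
*)
theory Submission
  imports Defs
begin

text \<open>The endpoints of I3 are the values of s at which |m \<kappa> - N s| = 2 sqrt(m N) for N
  = t (left) and N = t - 2 (right), two consecutive integers of the parity of t. So s in I3 says
  that neither of them is a possible value of N, and monotonicity in N disposes of all others of
  that parity. The coordinate D_i is delicate because the bound on the trace of m \<alpha>, namely 2
  m \<kappa> s + 4 m, nearly permits it: a nonzero D_i contributes at least r, while 2 m \<kappa> <=
  sqrt r gives 2 m \<kappa> s < r. The slack 4 m is absorbed by B_i: the conjugate equation keeps
  B_i sqrt p within 2 sqrt m of D_i sqrt r, so for sqrt r >= 4 sqrt m the term in B_i alone adds at
  least 4 m. That every integer of the field has coordinates in (1/2) Z, with the parity relation,
  is derived without an integral basis, from traces and relative norms of the conjugates obtained by
  changing signs of the square roots.\<close>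

section \<open>Denominators of rational numbers\<close>

text \<open>For \<open>w\<close> = m/n in lowest terms, n^2 divides \<open>s\<close> m^2, hence
  \<open>s\<close>, and squarefreeness leaves n = 1. This clears denominators from coordinates that
  are only known through a relative norm.\<close>

lemma squarefree_mult_square_Ints:
  fixes s :: nat and w :: real
  assumes "squarefree s" "w \<in> \<rat>" "real s * w\<^sup>2 \<in> \<int>"
  shows "w \<in> \<int>"
proof -
  obtain m n :: int where w: "w = of_int m / of_int n" and n: "n > 0" and cop: "coprime m n"
    using Rats_cases'[OF assms(2)] by metis
  obtain k where k: "real s * w\<^sup>2 = of_int k" using assms(3) by (auto elim: Ints_cases)
  have "real s * (of_int m)\<^sup>2 = of_int k * (of_int n)\<^sup>2"
    using k n by (simp add: w field_simps)
  hence "real_of_int (int s * m\<^sup>2) = of_int (k * n\<^sup>2)" by simp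
  hence "int s * m\<^sup>2 = k * n\<^sup>2" by linarith
  hence "n\<^sup>2 dvd int s * m\<^sup>2" by simp
  hence "n\<^sup>2 dvd int s"
    using cop by (simp add: coprime_commute coprime_dvd_mult_left_iff)
  hence "(nat n)\<^sup>2 dvd s"
    using n by (metis int_dvd_int_iff int_nat_eq less_imp_le of_nat_power)
  hence "nat n dvd 1" using assms(1) by (simp only: squarefree_def)
  hence "n = 1" using n by simp
  thus ?thesis using w by simp
qed

text \<open>All powers of the reduced denominator n divide the fixed number \<open>N\<close>, so n >
  1 would give 2^N <= n^N <= N. This takes the place of the fact that a rational algebraic integer
  is an integer.\<close>

lemma Ints_of_bounded_denominator_powers:
  fixes a :: real and N :: nat
  assumes "a \<in> \<rat>" "N > 0" "\<And>k. real N * a ^ k \<in> \<int>"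
  shows "a \<in> \<int>"
proof -
  obtain m n :: int where a: "a = of_int m / of_int n" and n: "n > 0" and cop: "coprime m n"
    using Rats_cases'[OF assms(1)] by metis
  have dvd: "n ^ k dvd int N" for k
  proof -
    obtain l where l: "real N * a ^ k = of_int l" using assms(3)[of k] by (auto elim: Ints_cases)
    have "real N * (of_int m) ^ k = of_int l * (of_int n) ^ k"
      using l n by (simp add: a field_simps)
    hence "real_of_int (int N * m ^ k) = of_int (l * n ^ k)" by simp
    hence "int N * m ^ k = l * n ^ k" by linarith
    hence "n ^ k dvd int N * m ^ k" by simp
    moreover have "coprime (n ^ k) (m ^ k)" using cop by (simp add: coprime_commute)
    ultimately show ?thesis by (simp add: coprime_dvd_mult_left_iff)
  qed
  have "n = 1"
  proof (rule ccontr)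
    assume "n \<noteq> 1"
    hence "2 \<le> n" using n by simp
    have "int N < 2 ^ N" by (metis of_nat_less_two_power)
    also have "\<dots> \<le> n ^ N" using \<open>2 \<le> n\<close> by (intro power_mono) auto
    also have "\<dots> \<le> int N" using dvd[of N] assms(2) by (intro zdvd_imp_le) auto
    finally show False by simp
  qed
  thus ?thesis using a by simp
qed

text \<open>Were the root rational, its inverse \<open>w\<close> would satisfy s w^2 = 1 and thus be
  an integer strictly between 0 and 1.\<close>

lemma sqrt_not_Rats:
  fixes s :: nat
  assumes "squarefree s" "2 \<le> s"
  shows "sqrt (real s) \<notin> \<rat>"
proof
  assume rat: "sqrt (real s) \<in> \<rat>"
  define w where "w = inverse (sqrt (real s))"
  have "real s * w\<^sup>2 = 1" using assms(2) by (simp add: w_def field_simps)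
  moreover have "w \<in> \<rat>" using rat by (simp add: w_def)
  ultimately have "w \<in> \<int>" using squarefree_mult_square_Ints[OF assms(1), of w] by simp
  moreover have "0 < w" "w < 1" using assms(2) by (auto simp: w_def field_simps real_less_rsqrt)
  ultimately show False by (auto elim!: Ints_cases)
qed

section \<open>Integers of biquadratic fields\<close>

text \<open>
  Abstractly \<open>P\<close>, \<open>Q\<close>, \<open>R\<close> are square roots of \<open>p = p\<^sub>0 g\<close>, \<open>q = q\<^sub>0 g\<close>, \<open>r = p\<^sub>0 q\<^sub>0\<close>
  with \<open>g = gcd p q\<close>.  No signs are fixed, so that the conjugates of the field are again instances
  of the locale.
\<close>

locale biquadratic =
  fixes p\<^sub>0 q\<^sub>0 g :: nat and P Q R :: real
  assumes pos: "p\<^sub>0 > 0" "q\<^sub>0 > 0" "g > 0"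
    and mults: "P * P = p\<^sub>0 * g" "Q * Q = q\<^sub>0 * g" "R * R = p\<^sub>0 * q\<^sub>0"
      "P * Q = g * R" "P * R = p\<^sub>0 * Q" "Q * R = q\<^sub>0 * P"
    and irrational: "P \<notin> \<rat>" "Q \<notin> \<rat>" "R \<notin> \<rat>"
begin

definition comb :: "real \<Rightarrow> real \<Rightarrow> real \<Rightarrow> real \<Rightarrow> real" where
  "comb a b c d = a + b * P + c * Q + d * R"

lemma comb_add: "comb a b c d + comb a' b' c' d' = comb (a + a') (b + b') (c + c') (d + d')"
  by (simp add: comb_def algebra_simps)

lemma comb_scale: "x * comb a b c d = comb (x * a) (x * b) (x * c) (x * d)"
  by (simp add: comb_def algebra_simps)

lemma comb_sum: "(\<Sum>i\<in>I. comb (a i) (b i) (c i) (d i)) = comb (sum a I) (sum b I) (sum c I) (sum d I)"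
  by (simp add: comb_def sum.distrib sum_distrib_right)

lemma comb_mult:
  fixes a b c d a' b' c' d' :: real
  shows "comb a b c d * comb a' b' c' d' =
     comb (a * a' + p\<^sub>0 * g * b * b' + q\<^sub>0 * g * c * c' + p\<^sub>0 * q\<^sub>0 * d * d')
          (a * b' + b * a' + q\<^sub>0 * (c * d' + d * c'))
          (a * c' + c * a' + p\<^sub>0 * (b * d' + d * b'))
          (a * d' + d * a' + g * (b * c' + c * b'))"
proof -
  have "comb a b c d * comb a' b' c' d' = a * a' + b * b' * (P * P) + c * c' * (Q * Q) + d * d' * (R * R)
     + (a * b' + b * a') * P + (a * c' + c * a') * Q + (a * d' + d * a') * R
     + (b * c' + c * b') * (P * Q) + (b * d' + d * b') * (P * R) + (c * d' + d * c') * (Q * R)"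
    by (simp add: comb_def algebra_simps)
  thus ?thesis unfolding mults by (simp add: comb_def algebra_simps)
qed

text \<open>Linear independence of 1, \<open>P\<close>, \<open>Q\<close>, \<open>R\<close> over the
  rationals. With R = P Q / g the relation reads (a + b P) + (c + e P) Q = 0. If c + e P is nonzero,
  then Q = u + v P; squaring makes P rational unless u v = 0, and v = 0 makes Q rational, u = 0
  makes R rational.\<close>

lemma comb_eq_0:
  assumes "a \<in> \<rat>" "b \<in> \<rat>" "c \<in> \<rat>" "d \<in> \<rat>" "comb a b c d = 0"
  shows "a = 0 \<and> b = 0 \<and> c = 0 \<and> d = 0"
proof -
  note irr = irrational
  have lin: "u = 0 \<and> v = 0" if "u \<in> \<rat>" "v \<in> \<rat>" "u + v * P = 0" for u v
  proof -
    have "v = 0"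
    proof (rule ccontr)
      assume "v \<noteq> 0"
      hence "P = - u / v" using that(3) by (simp add: field_simps)
      thus False using irr(1) that by simp
    qed
    thus ?thesis using that by simp
  qed
  have gR: "R = P * Q / g" using mults(4) pos by (simp add: field_simps)
  define e where "e = d / g"
  have e: "e \<in> \<rat>" "d = 0 \<longleftrightarrow> e = 0" using assms(4) pos by (auto simp: e_def)
  have eq: "a + b * P + (c + e * P) * Q = 0"
    using assms(5)[unfolded comb_def] by (simp add: gR e_def algebra_simps)
  show ?thesis
  proof (cases "c + e * P = 0")
    case True
    hence "c = 0" "e = 0" using lin[of c e] assms e by auto
    moreover from True have "a + b * P = 0" using eq by simp
    ultimately show ?thesis using lin[of a b] assms e by auto
  next
    case False
    \<comment> \<open>The norm of c + e P from the field of \<open>P\<close> to the rationals;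
      multiplying by the conjugate c - e P solves the relation for \<open>Q\<close> with rational
      coefficients.\<close>
    define N where "N = c * c - e * e * (p\<^sub>0 * g)"
    have N: "N = (c + e * P) * (c - e * P)"
    proof -
      have "(c + e * P) * (c - e * P) = c * c - e * e * (P * P)"
        by (simp add: algebra_simps)
      thus ?thesis by (simp only: mults(1) N_def of_nat_mult)
    qed
    have "c - e * P \<noteq> 0"
    proof
      assume "c - e * P = 0"
      hence "c = 0 \<and> - e = 0" using assms e by (intro lin) auto
      thus False using False by simp
    qed
    hence "N \<noteq> 0" using False N by simp
    have NQ: "N \<in> \<rat>" using assms e by (auto simp: N_def)
    define u where "u = - (a * c - b * e * (p\<^sub>0 * g)) / N"
    define v where "v = - (b * c - a * e) / N"
    have uv: "u \<in> \<rat>" "v \<in> \<rat>" using assms e NQ by (auto simp: u_def v_def)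
    have "N * Q = (c - e * P) * ((c + e * P) * Q)" by (simp add: N algebra_simps)
    also have "(c + e * P) * Q = - (a + b * P)" using eq by linarith
    also have "(c - e * P) * - (a + b * P) =
       - (a * c - b * e * (P * P)) + - (b * c - a * e) * P"
      by (simp add: algebra_simps)
    also have "\<dots> = N * (u + v * P)"
      using \<open>N \<noteq> 0\<close> by (simp add: mults(1) u_def v_def algebra_simps)
    finally have Quv: "Q = u + v * P" using \<open>N \<noteq> 0\<close> by simp
    have "v \<noteq> 0" using Quv irr(2) uv by auto
    have "u = 0"
    proof (rule ccontr)
      assume "u \<noteq> 0"
      have "Q * Q = u * u + v * v * (P * P) + 2 * u * v * P" by (simp add: Quv algebra_simps)
      hence "P = (q\<^sub>0 * g - u * u - v * v * (p\<^sub>0 * g)) / (2 * u * v)"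
        using \<open>u \<noteq> 0\<close> \<open>v \<noteq> 0\<close> by (simp add: mults(1,2) field_simps)
      moreover have "(q\<^sub>0 * g - u * u - v * v * (p\<^sub>0 * g)) / (2 * u * v) \<in> \<rat>" using uv by auto
      ultimately show False using irr(1) by simp
    qed
    hence "R = v * (P * P) / g" using Quv gR by simp
    hence "R = v * (p\<^sub>0 * g) / g" by (simp only: mults(1))
    also have "\<dots> \<in> \<rat>" using uv by auto
    finally show ?thesis using irr(3) by simp
  qed
qed

lemma comb_cong:
  assumes "a \<in> \<rat>" "b \<in> \<rat>" "c \<in> \<rat>" "d \<in> \<rat>" "a' \<in> \<rat>" "b' \<in> \<rat>" "c' \<in> \<rat>" "d' \<in> \<rat>"
    and "comb a b c d = comb a' b' c' d'"
  shows "a = a'" "b = b'" "c = c'" "d = d'"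
proof -
  have "comb (a - a') (b - b') (c - c') (d - d') = 0"
    using assms(9) by (simp add: comb_def algebra_simps)
  hence "a - a' = 0 \<and> b - b' = 0 \<and> c - c' = 0 \<and> d - d' = 0" using assms by (intro comb_eq_0) auto
  thus "a = a'" "b = b'" "c = c'" "d = d'" by auto
qed

section \<open>Numbers whose powers have bounded denominator\<close>

text \<open>An order of the field, in general smaller than the full ring of integers. It is closed
  under products because the structure constants in \<open>comb_mult\<close> are integers.\<close>

definition lattice :: "real set" where
  "lattice = {comb a b c d | a b c d. a \<in> \<int> \<and> b \<in> \<int> \<and> c \<in> \<int> \<and> d \<in> \<int>}"

lemma latticeI: "a \<in> \<int> \<Longrightarrow> b \<in> \<int> \<Longrightarrow> c \<in> \<int> \<Longrightarrow> d \<in> \<int> \<Longrightarrow> comb a b c d \<in> lattice"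
  unfolding lattice_def by blast

lemma Ints_lattice: "x \<in> \<int> \<Longrightarrow> x \<in> lattice"
  using latticeI[of x 0 0 0] by (simp add: comb_def)

lemma lattice_add: "x \<in> lattice \<Longrightarrow> y \<in> lattice \<Longrightarrow> x + y \<in> lattice"
  unfolding lattice_def by (clarsimp simp: comb_add) (blast intro: Ints_add)

lemma lattice_mult:
  assumes "x \<in> lattice" "y \<in> lattice" shows "x * y \<in> lattice"
proof -
  obtain a b c d a' b' c' d' where "a \<in> \<int>" "b \<in> \<int>" "c \<in> \<int>" "d \<in> \<int>" "x = comb a b c d"
    "a' \<in> \<int>" "b' \<in> \<int>" "c' \<in> \<int>" "d' \<in> \<int>" "y = comb a' b' c' d'"
    using assms unfolding lattice_def by blast
  thus ?thesis by (simp only: comb_mult) (intro latticeI Ints_add Ints_mult; simp)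
qed

lemma lattice_sum: "(\<And>i. i \<in> I \<Longrightarrow> f i \<in> lattice) \<Longrightarrow> sum f I \<in> lattice"
  by (induction I rule: infinite_finite_induct) (auto intro: lattice_add Ints_lattice)

lemma lattice_Rats_Ints:
  assumes "x \<in> lattice" "x \<in> \<rat>" shows "x \<in> \<int>"
proof -
  obtain a b c d where *: "a \<in> \<int>" "b \<in> \<int>" "c \<in> \<int>" "d \<in> \<int>" "x = comb a b c d"
    using assms(1) unfolding lattice_def by blast
  have "comb a b c d = comb x 0 0 0" using * by (simp add: comb_def)
  hence "a = x" using * assms(2) Ints_subset_Rats by (intro comb_cong(1)[of a b c d x 0 0 0]) auto
  thus ?thesis using * by simp
qed

text \<open>
  Algebraic integers of the field have powers of bounded denominator, and closure of the latter
  property under sums and products is immediate from the binomial theorem; this replaces the fact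
  that the algebraic integers form a ring.
\<close>

definition almost_integral :: "real \<Rightarrow> bool" where
  "almost_integral x \<longleftrightarrow> (\<exists>N::nat. N > 0 \<and> (\<forall>k. real N * x ^ k \<in> lattice))"

lemma almost_integral_add:
  assumes "almost_integral x" "almost_integral y" shows "almost_integral (x + y)"
proof -
  obtain M N :: nat where M: "M > 0" "\<And>k. real M * x ^ k \<in> lattice"
    and N: "N > 0" "\<And>k. real N * y ^ k \<in> lattice"
    using assms unfolding almost_integral_def by blast
  have "real (M * N) * (x + y) ^ k \<in> lattice" for k
  proof -
    have "real (M * N) * (x + y) ^ k =
        (\<Sum>i\<le>k. real (k choose i) * ((real M * x ^ i) * (real N * y ^ (k - i))))"
      by (simp add: binomial_ring sum_distrib_left mult_ac)
    also have "\<dots> \<in> lattice"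
      by (intro lattice_sum lattice_mult M N Ints_lattice Ints_of_nat)
    finally show ?thesis .
  qed
  thus ?thesis using M N unfolding almost_integral_def by (intro exI[of _ "M * N"]) auto
qed

lemma almost_integral_mult:
  assumes "almost_integral x" "almost_integral y" shows "almost_integral (x * y)"
proof -
  obtain M N :: nat where M: "M > 0" "\<And>k. real M * x ^ k \<in> lattice"
    and N: "N > 0" "\<And>k. real N * y ^ k \<in> lattice"
    using assms unfolding almost_integral_def by blast
  have "real (M * N) * (x * y) ^ k \<in> lattice" for k
    using lattice_mult[OF M(2)[of k] N(2)[of k]] by (simp add: power_mult_distrib mult_ac)
  thus ?thesis using M N unfolding almost_integral_def by (intro exI[of _ "M * N"]) auto
qed

lemma almost_integral_Rats: "almost_integral x \<Longrightarrow> x \<in> \<rat> \<Longrightarrow> x \<in> \<int>"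
  unfolding almost_integral_def
  by (metis Ints_of_bounded_denominator_powers lattice_Rats_Ints Rats_mult Rats_of_nat Rats_power)

definition rational_span :: "real set" where
  "rational_span = {comb a b c d | a b c d. a \<in> \<rat> \<and> b \<in> \<rat> \<and> c \<in> \<rat> \<and> d \<in> \<rat>}"

lemma rational_spanI: "a \<in> \<rat> \<Longrightarrow> b \<in> \<rat> \<Longrightarrow> c \<in> \<rat> \<Longrightarrow> d \<in> \<rat> \<Longrightarrow> comb a b c d \<in> rational_span"
  unfolding rational_span_def by blast

lemma rational_spanE:
  assumes "x \<in> rational_span"
  obtains a b c d where "a \<in> \<rat>" "b \<in> \<rat>" "c \<in> \<rat>" "d \<in> \<rat>" "x = comb a b c d"
  using assms unfolding rational_span_def by blast

lemma rational_span_add: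
  assumes "x \<in> rational_span" "y \<in> rational_span" shows "x + y \<in> rational_span"
proof -
  obtain a b c d a' b' c' d' where "a \<in> \<rat>" "b \<in> \<rat>" "c \<in> \<rat>" "d \<in> \<rat>" "x = comb a b c d"
    "a' \<in> \<rat>" "b' \<in> \<rat>" "c' \<in> \<rat>" "d' \<in> \<rat>" "y = comb a' b' c' d'"
    using assms unfolding rational_span_def by blast
  thus ?thesis by (simp only: comb_add) (intro rational_spanI Rats_add; simp)
qed

lemma rational_span_mult:
  assumes "x \<in> rational_span" "y \<in> rational_span" shows "x * y \<in> rational_span"
proof -
  obtain a b c d a' b' c' d' where "a \<in> \<rat>" "b \<in> \<rat>" "c \<in> \<rat>" "d \<in> \<rat>" "x = comb a b c d"
    "a' \<in> \<rat>" "b' \<in> \<rat>" "c' \<in> \<rat>" "d' \<in> \<rat>" "y = comb a' b' c' d'"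
    using assms unfolding rational_span_def by blast
  thus ?thesis by (simp only: comb_mult) (intro rational_spanI Rats_add Rats_mult; simp)
qed

lemma Rats_rational_span: "x \<in> \<rat> \<Longrightarrow> x \<in> rational_span"
  using rational_spanI[of x 0 0 0] by (simp add: comb_def)

lemma rational_span_power: "x \<in> rational_span \<Longrightarrow> x ^ k \<in> rational_span"
  by (induction k) (auto intro: rational_span_mult Rats_rational_span)

lemma rational_span_denominator:
  assumes "x \<in> rational_span"
  obtains N :: nat where "N > 0" "real N * x \<in> lattice"
proof -
  have *: "\<exists>N>0. real N * a \<in> \<int>" if a: "a \<in> \<rat>" for a :: real
  proof -
    obtain m n :: int where "a = of_int m / of_int n" "n > 0" using Rats_cases'[OF a] by metis
    thus ?thesis by (intro exI[of _ "nat n"]) auto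
  qed
  obtain a b c d where x: "a \<in> \<rat>" "b \<in> \<rat>" "c \<in> \<rat>" "d \<in> \<rat>" "x = comb a b c d"
    using assms by (rule rational_spanE)
  obtain A B C D :: nat where N: "A > 0" "real A * a \<in> \<int>" "B > 0" "real B * b \<in> \<int>"
    "C > 0" "real C * c \<in> \<int>" "D > 0" "real D * d \<in> \<int>" using *[of a] *[of b] *[of c] *[of d] x by blast
  show ?thesis
  proof
    show "A * B * C * D > 0" using N by simp
    have "real (A * B * C * D) * x = comb (real (B * C * D) * (real A * a)) (real (A * C * D) * (real B * b))
       (real (A * B * D) * (real C * c)) (real (A * B * C) * (real D * d))"
      by (simp add: x comb_scale mult_ac)
    also have "\<dots> \<in> lattice" by (intro latticeI Ints_mult N) auto
    finally show "real (A * B * C * D) * x \<in> lattice" .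
  qed
qed

text \<open>A common denominator of the powers of \<open>x\<close> below the degree of a monic
  integral equation serves for all powers, since the equation rewrites every higher power as an
  integral combination of lower ones.\<close>

lemma algebraic_int_almost_integral:
  assumes "algebraic_int x" "x \<in> rational_span"
  shows "almost_integral x"
proof -
  obtain f where f: "lead_coeff f = 1" "\<forall>i. coeff f i \<in> \<int>" "poly f x = 0"
    using assms(1) by (auto elim: algebraic_int.cases)
  define n where "n = degree f"
  have "\<exists>N>0. \<forall>k<n. real N * x ^ k \<in> lattice"
  proof (induction n)
    case (Suc n)
    then obtain N where N: "N > 0" "\<And>k. k < n \<Longrightarrow> real N * x ^ k \<in> lattice" by blast
    obtain M :: nat where M: "M > 0" "real M * x ^ n \<in> lattice"
      using rational_span_denominator rational_span_power[OF assms(2)] by blast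
    have "real (M * N) * x ^ k \<in> lattice" if "k < Suc n" for k
    proof (cases "k = n")
      case True
      thus ?thesis using lattice_mult[OF Ints_lattice[of "real N"] M(2)] by (simp add: mult_ac)
    next
      case False
      thus ?thesis
        using that lattice_mult[OF Ints_lattice[of "real M"] N(2)[of k]] by (simp add: mult_ac)
    qed
    thus ?case using M N by (intro exI[of _ "M * N"]) auto
  qed auto
  then obtain N where N: "N > 0" "\<And>k. k < n \<Longrightarrow> real N * x ^ k \<in> lattice" by blast
  have "x ^ n = (\<Sum>i<n. - coeff f i * x ^ i)"
  proof -
    have "0 = (\<Sum>i\<le>n. coeff f i * x ^ i)" using f(3) by (simp add: poly_altdef n_def)
    also have "\<dots> = (\<Sum>i<n. coeff f i * x ^ i) + x ^ n"
      using f(1) by (simp add: n_def lessThan_Suc_atMost[symmetric])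
    finally show ?thesis by (simp add: sum_negf)
  qed
  hence red: "real N * x ^ (k + n) = (\<Sum>i<n. - coeff f i * (real N * x ^ (k + i)))" for k
    by (simp add: power_add sum_distrib_left mult_ac)
  have "real N * x ^ k \<in> lattice" for k
  proof (induction k rule: less_induct)
    case (less k)
    show ?case
    proof (cases "k < n")
      case False
      define l where "l = k - n"
      have k: "k = l + n" using False by (simp add: l_def)
      have "(\<Sum>i<n. - coeff f i * (real N * x ^ (l + i))) \<in> lattice"
        using f(2) by (intro lattice_sum lattice_mult less Ints_lattice) (auto simp: k)
      thus ?thesis using red[of l] k by simp
    qed (use N in auto)
  qed
  thus ?thesis using N unfolding almost_integral_def by blast
qed

end

section \<open>Conjugates and the coordinates of algebraic integers\<close>

text \<open>The multiplication rule for coordinates involves only \<open>p\<^sub>0\<close>,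
  \<open>q\<^sub>0\<close>, \<open>g\<close>, not the chosen roots. Hence the relation
  \<open>conj\<close> of having equal rational coordinates respects sums and products, and so the
  values of an integral polynomial. As 0 has only zero coordinates, a root on one side corresponds
  to a root on the other.\<close>

lemma algebraic_int_conjugate:
  fixes a b c d :: real
  assumes "biquadratic p\<^sub>0 q\<^sub>0 g P Q R" "biquadratic p\<^sub>0 q\<^sub>0 g P' Q' R'"
    and rat: "a \<in> \<rat>" "b \<in> \<rat>" "c \<in> \<rat>" "d \<in> \<rat>"
    and int: "algebraic_int (biquadratic.comb P Q R a b c d)"
  shows "algebraic_int (biquadratic.comb P' Q' R' a b c d)"
proof -
  interpret A: biquadratic p\<^sub>0 q\<^sub>0 g P Q R by fact
  interpret B: biquadratic p\<^sub>0 q\<^sub>0 g P' Q' R' by fact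
  define conj where "conj x y \<longleftrightarrow> (\<exists>a\<in>\<rat>. \<exists>b\<in>\<rat>. \<exists>c\<in>\<rat>. \<exists>d\<in>\<rat>. x = A.comb a b c d \<and> y = B.comb a b c d)"
    for x y :: real
  have conjI: "conj (A.comb a b c d) (B.comb a b c d)"
    if "a \<in> \<rat>" "b \<in> \<rat>" "c \<in> \<rat>" "d \<in> \<rat>" for a b c d
    unfolding conj_def using that by blast
  have conj_Rats: "conj x x" if "x \<in> \<rat>" for x
    using conjI[of x 0 0 0] that by (simp add: A.comb_def B.comb_def)
  have conj_add: "conj (x + x') (y + y')" if xy: "conj x y" "conj x' y'" for x y x' y'
  proof -
    obtain a b c d a' b' c' d' where "a \<in> \<rat>" "b \<in> \<rat>" "c \<in> \<rat>" "d \<in> \<rat>" "x = A.comb a b c d" "y = B.comb a b c d"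
      "a' \<in> \<rat>" "b' \<in> \<rat>" "c' \<in> \<rat>" "d' \<in> \<rat>" "x' = A.comb a' b' c' d'" "y' = B.comb a' b' c' d'"
      using xy unfolding conj_def by blast
    thus ?thesis by (simp only: A.comb_add B.comb_add) (intro conjI Rats_add; simp)
  qed
  have conj_mult: "conj (x * x') (y * y')" if xy: "conj x y" "conj x' y'" for x y x' y'
  proof -
    obtain a b c d a' b' c' d' where "a \<in> \<rat>" "b \<in> \<rat>" "c \<in> \<rat>" "d \<in> \<rat>" "x = A.comb a b c d" "y = B.comb a b c d"
      "a' \<in> \<rat>" "b' \<in> \<rat>" "c' \<in> \<rat>" "d' \<in> \<rat>" "x' = A.comb a' b' c' d'" "y' = B.comb a' b' c' d'"
      using xy unfolding conj_def by blast
    thus ?thesis by (simp only: A.comb_mult B.comb_mult) (intro conjI Rats_add Rats_mult; simp)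
  qed
  define x y where "x = A.comb a b c d" and "y = B.comb a b c d"
  obtain f where f: "lead_coeff f = 1" "\<forall>i. coeff f i \<in> \<int>" "poly f x = 0"
    using int by (auto elim: algebraic_int.cases simp: x_def)
  have "conj (poly f x) (poly f y)" if "\<forall>i. coeff f i \<in> \<int>" for f
    using that
  proof (induction f)
    case 0
    show ?case using conj_Rats[of 0] by simp
  next
    case (pCons k f)
    have k: "k \<in> \<int>" using pCons.prems by (metis coeff_pCons_0)
    have "\<forall>i. coeff f i \<in> \<int>" using pCons.prems by (metis coeff_pCons_Suc)
    hence "conj (poly f x) (poly f y)" by (rule pCons.IH)
    moreover have "conj x y" unfolding x_def y_def by (intro conjI rat)
    moreover have "conj k k" using k Ints_subset_Rats by (intro conj_Rats) auto
    ultimately show ?case by (simp add: conj_add conj_mult)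
  qed
  hence "conj 0 (poly f y)" using f by metis
  then obtain a b c d where "a \<in> \<rat>" "b \<in> \<rat>" "c \<in> \<rat>" "d \<in> \<rat>" "A.comb a b c d = 0" "poly f y = B.comb a b c d"
    unfolding conj_def by metis
  hence "poly f y = 0" using A.comb_eq_0[of a b c d] by (simp add: B.comb_def)
  thus ?thesis using f unfolding y_def by (intro algebraic_int.intros) auto
qed

lemma square_mod_4: "(a::int)\<^sup>2 mod 4 = (if even a then 0 else 1)"
proof (cases "even a")
  case False
  then obtain b where "a = 2 * b + 1" by (elim oddE)
  hence "a\<^sup>2 = 4 * (b\<^sup>2 + b) + 1" by (simp add: power2_eq_square algebra_simps)
  thus ?thesis using False by presburger
qed (auto elim!: evenE simp: power2_eq_square)

lemma minus_mult_square_mod_4: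
  "(x - s * (v::int)\<^sup>2) mod 4 = (x mod 4 - (s mod 4) * (if even v then 0 else 1)) mod 4"
  unfolding square_mod_4[symmetric] by (intro mod_diff_cong) (simp_all only: mod_mod_trivial mod_mult_eq)

context biquadratic
begin

lemma biquadratic_signs:
  shows "biquadratic p\<^sub>0 q\<^sub>0 g (- P) Q (- R)" "biquadratic p\<^sub>0 q\<^sub>0 g P (- Q) (- R)"
    "biquadratic p\<^sub>0 q\<^sub>0 g (- P) (- Q) R"
  by (unfold_locales; use pos mults irrational in simp)+

lemma algebraic_int_conjugates:
  fixes a b c d :: real
  assumes "a \<in> \<rat>" "b \<in> \<rat>" "c \<in> \<rat>" "d \<in> \<rat>" "algebraic_int (comb a b c d)"
  shows "algebraic_int (comb a (- b) c (- d))" "algebraic_int (comb a b (- c) (- d))"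
    "algebraic_int (comb a (- b) (- c) d)"
proof -
  interpret c1: biquadratic p\<^sub>0 q\<^sub>0 g "- P" Q "- R" by (rule biquadratic_signs)
  interpret c2: biquadratic p\<^sub>0 q\<^sub>0 g P "- Q" "- R" by (rule biquadratic_signs)
  interpret c3: biquadratic p\<^sub>0 q\<^sub>0 g "- P" "- Q" R by (rule biquadratic_signs)
  have "c1.comb a b c d = comb a (- b) c (- d)" "c2.comb a b c d = comb a b (- c) (- d)"
    "c3.comb a b c d = comb a (- b) (- c) d"
    by (simp_all add: comb_def c1.comb_def c2.comb_def c3.comb_def)
  thus "algebraic_int (comb a (- b) c (- d))" "algebraic_int (comb a b (- c) (- d))"
    "algebraic_int (comb a (- b) (- c) d)"
    using algebraic_int_conjugate[OF biquadratic_axioms c1.biquadratic_axioms assms]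
      algebraic_int_conjugate[OF biquadratic_axioms c2.biquadratic_axioms assms]
      algebraic_int_conjugate[OF biquadratic_axioms c3.biquadratic_axioms assms] by simp_all
qed

text \<open>
  The trace \<open>4 a\<close> and the relative norms \<open>(2 a)\<^sup>2 - s (2 b)\<^sup>2\<close> of the traces to the three quadratic
  subfields are integers, which bounds the denominators of the coordinates.
\<close>

lemma algebraic_int_coordinates:
  fixes a b c d :: real
  assumes sqf: "squarefree (p\<^sub>0 * g)" "squarefree (q\<^sub>0 * g)" "squarefree (p\<^sub>0 * q\<^sub>0)"
    and mod: "int (p\<^sub>0 * g) mod 4 \<in> {2, 3}" "int (q\<^sub>0 * g) mod 4 = 1" "int (p\<^sub>0 * q\<^sub>0) mod 4 \<in> {2, 3}"
    and rat: "a \<in> \<rat>" "b \<in> \<rat>" "c \<in> \<rat>" "d \<in> \<rat>" and int: "algebraic_int (comb a b c d)"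
  shows "\<exists>A B C D :: int. a = of_int A / 2 \<and> b = of_int B / 2 \<and> c = of_int C / 2 \<and> d = of_int D / 2
           \<and> (D = 0 \<longrightarrow> even (A - C))"
proof -
  define x x\<^sub>1 x\<^sub>2 x\<^sub>3 where "x = comb a b c d" and "x\<^sub>1 = comb a (- b) c (- d)"
    and "x\<^sub>2 = comb a b (- c) (- d)" and "x\<^sub>3 = comb a (- b) (- c) d"
  note x_defs = x_def x\<^sub>1_def x\<^sub>2_def x\<^sub>3_def
  have ai: "almost_integral x" "almost_integral x\<^sub>1" "almost_integral x\<^sub>2" "almost_integral x\<^sub>3"
    unfolding x_defs using int algebraic_int_conjugates[OF rat int] rat
    by (auto intro!: algebraic_int_almost_integral rational_spanI)
  note ai_add = almost_integral_add and ai_mult = almost_integral_mult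
  have "almost_integral (x + x\<^sub>1 + (x\<^sub>2 + x\<^sub>3))" by (intro ai_add ai)
  moreover have "x + x\<^sub>1 + (x\<^sub>2 + x\<^sub>3) = 4 * a" by (simp add: x_defs comb_def)
  ultimately have "4 * a \<in> \<int>" using rat by (metis almost_integral_Rats Rats_mult Rats_number_of)
  then obtain A4 where A4: "4 * a = of_int A4" by (metis Ints_cases)
  \<comment> \<open>The hypothesis concerns the norm of the relative trace 2a + 2b sqrt s. Four
    times it, together with the integrality of 4a, makes s (4b)^2 an integer, and \<open>s\<close>
    is squarefree. The resulting congruence modulo 4 is kept for the parity arguments.\<close>
  have coord: "\<exists>B k :: int. 4 * b = of_int B \<and> A4\<^sup>2 - int s * B\<^sup>2 = 4 * k"
    if "squarefree s" "b \<in> \<rat>" "almost_integral (4 * a\<^sup>2 - 4 * s * b\<^sup>2)" for s :: nat and b :: real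
  proof -
    have "4 * a\<^sup>2 - 4 * s * b\<^sup>2 \<in> \<rat>" using rat that by auto
    hence "4 * a\<^sup>2 - 4 * s * b\<^sup>2 \<in> \<int>" using almost_integral_Rats that by blast
    then obtain k where k: "4 * a\<^sup>2 - 4 * s * b\<^sup>2 = of_int k" by (metis Ints_cases)
    have "s * (4 * b)\<^sup>2 = (4 * a)\<^sup>2 - 4 * (4 * a\<^sup>2 - 4 * s * b\<^sup>2)"
      by (simp add: power2_eq_square)
    hence eq: "s * (4 * b)\<^sup>2 = of_int (A4\<^sup>2 - 4 * k)"
      unfolding k A4 by (simp only: of_int_diff of_int_mult of_int_power of_int_numeral)
    hence "s * (4 * b)\<^sup>2 \<in> \<int>" by (simp only: Ints_of_int)
    moreover have "4 * b \<in> \<rat>" by (intro Rats_mult Rats_number_of that(2))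
    ultimately have "4 * b \<in> \<int>" using squarefree_mult_square_Ints[OF that(1)] by blast
    then obtain B where B: "4 * b = of_int B" by (metis Ints_cases)
    have "real_of_int (int s * B\<^sup>2) = of_int (A4\<^sup>2 - 4 * k)" 
      using eq unfolding B by (simp only: of_int_mult of_int_power of_int_of_nat_eq)
    hence "int s * B\<^sup>2 = A4\<^sup>2 - 4 * k" by linarith
    thus ?thesis using B by (intro exI[of _ B] exI[of _ k]) auto
  qed
  have "(x + x\<^sub>2) * (x\<^sub>1 + x\<^sub>3) = 4 * a\<^sup>2 - 4 * b\<^sup>2 * (P * P)"
    by (simp add: x_defs comb_def algebra_simps power2_eq_square)
  moreover have "almost_integral ((x + x\<^sub>2) * (x\<^sub>1 + x\<^sub>3))" by (intro ai_add ai_mult ai)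
  ultimately have "almost_integral (4 * a\<^sup>2 - 4 * (p\<^sub>0 * g) * b\<^sup>2)" by (simp add: mults mult_ac)
  then obtain B4 k1 :: int where B4: "4 * b = of_int B4" "A4\<^sup>2 - int (p\<^sub>0 * g) * B4\<^sup>2 = 4 * k1"
    using coord[of "p\<^sub>0 * g" b] sqf rat by auto
  have "(x + x\<^sub>1) * (x\<^sub>2 + x\<^sub>3) = 4 * a\<^sup>2 - 4 * c\<^sup>2 * (Q * Q)"
    by (simp add: x_defs comb_def algebra_simps power2_eq_square)
  moreover have "almost_integral ((x + x\<^sub>1) * (x\<^sub>2 + x\<^sub>3))" by (intro ai_add ai_mult ai)
  ultimately have "almost_integral (4 * a\<^sup>2 - 4 * (q\<^sub>0 * g) * c\<^sup>2)" by (simp add: mults mult_ac)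
  then obtain C4 k2 :: int where C4: "4 * c = of_int C4" "A4\<^sup>2 - int (q\<^sub>0 * g) * C4\<^sup>2 = 4 * k2"
    using coord[of "q\<^sub>0 * g" c] sqf rat by auto
  have "(x + x\<^sub>3) * (x\<^sub>1 + x\<^sub>2) = 4 * a\<^sup>2 - 4 * d\<^sup>2 * (R * R)"
    by (simp add: x_defs comb_def algebra_simps power2_eq_square)
  moreover have "almost_integral ((x + x\<^sub>3) * (x\<^sub>1 + x\<^sub>2))" by (intro ai_add ai_mult ai)
  ultimately have "almost_integral (4 * a\<^sup>2 - 4 * (p\<^sub>0 * q\<^sub>0) * d\<^sup>2)" by (simp add: mults mult_ac)
  then obtain D4 k3 :: int where D4: "4 * d = of_int D4" "A4\<^sup>2 - int (p\<^sub>0 * q\<^sub>0) * D4\<^sup>2 = 4 * k3"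
    using coord[of "p\<^sub>0 * q\<^sub>0" d] sqf rat by auto
  have even: "even u \<and> even v" if "u\<^sup>2 - s * v\<^sup>2 = 4 * k" "s mod 4 \<in> {2, 3}" for u v s k :: int
  proof -
    have "(u\<^sup>2 mod 4 - (s mod 4) * (if even v then 0 else 1)) mod 4 = 0"
      using that(1) minus_mult_square_mod_4[of "u\<^sup>2" s v] by simp
    thus ?thesis using that(2) by (auto simp: square_mod_4 split: if_splits)
  qed
  have parity: "even u \<longleftrightarrow> even v" if "u\<^sup>2 - s * v\<^sup>2 = 4 * k" "s mod 4 = 1" for u v s k :: int
  proof -
    have "(u\<^sup>2 mod 4 - (s mod 4) * (if even v then 0 else 1)) mod 4 = 0"
      using that(1) minus_mult_square_mod_4[of "u\<^sup>2" s v] by simp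
    thus ?thesis using that(2) by (auto simp: square_mod_4 split: if_splits)
  qed
  \<comment> \<open>A square is never 2 or 3 modulo 4, so the congruences for p and r force both of
    their entries to be even. The one for q only equates parities; evenness of \<open>C4\<close> is
    inherited from \<open>A4\<close>.\<close>
  have "even A4" "even B4" "even D4" using even[OF B4(2) mod(1)] even[OF D4(2) mod(3)] by auto
  moreover have "even C4" using parity[OF C4(2) mod(2)] \<open>even A4\<close> by simp
  ultimately obtain A B C D where ABCD: "A4 = 2 * A" "B4 = 2 * B" "C4 = 2 * C" "D4 = 2 * D"
    by (elim evenE)
  hence abcd: "a = of_int A / 2" "b = of_int B / 2" "c = of_int C / 2" "d = of_int D / 2"
    using A4 B4 C4 D4 by auto
  have "even (A - C)" if "D = 0"
  proof -
    have d0: "d = 0" using abcd that by simp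
    \<comment> \<open>With d = 0 the relative norm of \<open>x\<close> to the field of
      \<open>Q\<close> is u + 2ac Q; below, its trace 2u and its norm are shown to be
      integers.\<close>
    define u where "u = a\<^sup>2 + (q\<^sub>0 * g) * c\<^sup>2 - (p\<^sub>0 * g) * b\<^sup>2"
    have "x * x\<^sub>1 = a\<^sup>2 + c\<^sup>2 * (Q * Q) - b\<^sup>2 * (P * P) + 2 * a * c * Q"
      "x\<^sub>2 * x\<^sub>3 = a\<^sup>2 + c\<^sup>2 * (Q * Q) - b\<^sup>2 * (P * P) - 2 * a * c * Q"
      by (simp_all add: x_defs comb_def d0 algebra_simps power2_eq_square)
    hence xs: "x * x\<^sub>1 = u + 2 * a * c * Q" "x\<^sub>2 * x\<^sub>3 = u - 2 * a * c * Q"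
      by (simp_all add: mults u_def algebra_simps)
    have uQ: "u \<in> \<rat>" using rat by (auto simp: u_def)
    have "almost_integral (x * x\<^sub>1 + x\<^sub>2 * x\<^sub>3)" by (intro ai_add ai_mult ai)
    hence "almost_integral (2 * u)" by (simp add: xs)
    hence "2 * u \<in> \<int>" using uQ by (metis almost_integral_Rats Rats_mult Rats_number_of)
    then obtain U where U: "2 * u = of_int U" by (metis Ints_cases)
    have "almost_integral ((x * x\<^sub>1) * (x\<^sub>2 * x\<^sub>3))" by (intro ai_add ai_mult ai)
    moreover have "(x * x\<^sub>1) * (x\<^sub>2 * x\<^sub>3) = u\<^sup>2 - 4 * a\<^sup>2 * c\<^sup>2 * (Q * Q)"
      unfolding xs by (simp add: algebra_simps power2_eq_square)
    ultimately have "almost_integral (u\<^sup>2 - 4 * a\<^sup>2 * c\<^sup>2 * (q\<^sub>0 * g))" by (simp only: mults)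
    moreover have "u\<^sup>2 - 4 * a\<^sup>2 * c\<^sup>2 * (q\<^sub>0 * g) \<in> \<rat>" using uQ rat by auto
    ultimately have "u\<^sup>2 - 4 * a\<^sup>2 * c\<^sup>2 * (q\<^sub>0 * g) \<in> \<int>" using almost_integral_Rats by blast
    then obtain k where k: "u\<^sup>2 - 4 * a\<^sup>2 * c\<^sup>2 * (q\<^sub>0 * g) = of_int k" by (metis Ints_cases)
    have "(2 * u)\<^sup>2 - (q\<^sub>0 * g) * (4 * a * c)\<^sup>2 = 4 * (u\<^sup>2 - 4 * a\<^sup>2 * c\<^sup>2 * (q\<^sub>0 * g))"
      by (simp add: power2_eq_square)
    moreover have "4 * a * c = of_int (A * C)" by (simp add: abcd)
    ultimately have "real_of_int (U\<^sup>2 - int (q\<^sub>0 * g) * (A * C)\<^sup>2) = of_int (4 * k)"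
      unfolding k U by simp
    hence "U\<^sup>2 - int (q\<^sub>0 * g) * (A * C)\<^sup>2 = 4 * k" by linarith
    from parity[OF this mod(2)] have par: "even U \<longleftrightarrow> even (A * C)" .
    have "real_of_int (2 * U) = of_int (A\<^sup>2 + int (q\<^sub>0 * g) * C\<^sup>2 - int (p\<^sub>0 * g) * B\<^sup>2)"
      unfolding of_int_mult U[symmetric] by (simp add: u_def abcd power_divide)
    hence eq: "2 * U = A\<^sup>2 + int (q\<^sub>0 * g) * C\<^sup>2 - int (p\<^sub>0 * g) * B\<^sup>2" by linarith
    from par have "even (U - A * C)" by simp
    then obtain w where w: "U = A * C + 2 * w" by (metis evenE add_diff_cancel_left' diff_eq_eq add.commute)
    \<comment> \<open>Inserting U = A C + 2w into 2U = A^2 + q C^2 - p B^2 completes the square. As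
      q is 1 modulo 4, this leaves (A - C)^2 congruent to p B^2 modulo 4, which forces A - C to be
      even.\<close>
    have "(A - C)\<^sup>2 - int (p\<^sub>0 * g) * B\<^sup>2 = 4 * w - (int (q\<^sub>0 * g) - 1) * C\<^sup>2"
      using eq w by (simp add: power2_eq_square algebra_simps)
    moreover have "4 dvd int (q\<^sub>0 * g) - 1" using mod(2) by presburger
    then obtain j where "int (q\<^sub>0 * g) - 1 = 4 * j" by (elim dvdE)
    ultimately have "(A - C)\<^sup>2 - int (p\<^sub>0 * g) * B\<^sup>2 = 4 * w - 4 * j * C\<^sup>2" by (simp only:)
    hence "(A - C)\<^sup>2 - int (p\<^sub>0 * g) * B\<^sup>2 = 4 * (w - j * C\<^sup>2)" by (simp add: algebra_simps)
    from even[OF this mod(1)] show ?thesis by simp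
  qed
  thus ?thesis using abcd by blast
qed

end

section \<open>The intervals\<close>

text \<open>Divided by \<open>N\<close>, the bound says that s differs from M y^2 by less than h y,
  where y = 1 / sqrt N. The endpoints of \<open>I3\<close> are M z^2 + h z at z = 1 / sqrt t and M
  x^2 - h x at x = 1 / sqrt (t - 2). Parity rules out N = t - 1, so either N >= t or N <= t - 2, and
  each case violates one endpoint.\<close>

lemma I3_excludes:
  fixes m \<kappa> t N :: nat and s :: real
  assumes pos: "m > 0" "t > 0" "N > 0" and par: "even (N + t)" and s: "s > 0" "s \<in> I3 m \<kappa> t"
    and bnd: "\<bar>real (m * \<kappa>) - N * s\<bar> < 2 * sqrt m * sqrt N"
  shows False
proof -
  define M y where "M = real (m * \<kappa>)" and "y = 1 / sqrt N"
  define h where "h = 2 * sqrt m"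
  have y: "y > 0" "y * y * N = 1" using pos by (auto simp: y_def field_simps)
  have h: "h > 0" using pos by (simp add: h_def)
  have M: "M \<ge> 0" by (simp add: M_def)
  have "y * y * \<bar>M - N * s\<bar> < y * y * (h * sqrt N)"
    using bnd y unfolding M_def h_def by (intro mult_strict_left_mono) auto
  moreover have "y * y * \<bar>M - N * s\<bar> = \<bar>M * y * y - s\<bar>"
  proof -
    have "M * y * y - s = y * y * (M - N * s)" using y(2) by (simp add: algebra_simps)
    thus ?thesis by (simp add: abs_mult)
  qed
  moreover have "y * y * (h * sqrt N) = h * y" using pos by (simp add: y_def field_simps)
  ultimately have key: "\<bar>M * y * y - s\<bar> < h * y" by simp
  show False
  proof (cases "t \<le> N")
    case True
    define z where "z = 1 / sqrt t"
    have z: "y \<le> z" "z > 0" using True pos by (auto simp: y_def z_def intro!: divide_left_mono)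
    have "M * z * z + h * z \<le> s" using s(2) pos
      by (auto simp: I3_def Let_def z_def M_def h_def split: if_splits)
    moreover have "M * y * y \<le> M * z * z" using z y M by (intro mult_mono) auto
    moreover have "h * y \<le> h * z" using z h by simp
    ultimately show False using key by linarith
  next
    case False
    hence N: "N + 2 \<le> t" using par by presburger
    define x where "x = 1 / sqrt (real t - 2)"
    have t2: "real t - 2 > 0" "real N \<le> real t - 2" using N pos by auto
    have x: "x \<le> y" "x > 0" using t2 pos by (auto simp: y_def x_def intro!: divide_left_mono)
    have sx: "s \<le> M * x * x - h * x" using s(2) N pos t2
      by (auto simp: I3_def Let_def x_def M_def h_def split: if_splits)
    \<comment> \<open>The function M z^2 - h z need not be monotone near 0. Its value at
      \<open>x\<close> is at least s > 0, which gives M x > h, and from there on it increases, so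
      its value at \<open>y\<close> is no smaller.\<close>
    have "x * (M * x - h) > 0" using sx s(1) by (simp add: algebra_simps)
    hence "M * x > h" using x(2) by (simp add: zero_less_mult_iff)
    hence "M * (x + y) \<ge> h" using M y by (simp add: algebra_simps add_increasing2)
    hence "(y - x) * (M * (x + y) - h) \<ge> 0" using x by simp
    hence "M * x * x - h * x \<le> M * y * y - h * y" by (simp add: algebra_simps)
    thus False using sx key by linarith
  qed
qed

text \<open>With \<open>x = 1 / sqrt (t - 1)\<close> and \<open>y = 1 / sqrt t\<close> the length of \<open>I2\<close> is a positive multiple
  of \<open>sqrt m * \<kappa> * (x - y) - 2 * sqrt 2\<close>.\<close>

lemma I2_nonempty_iff:
  fixes m \<kappa> t :: nat
  assumes "m > 0" "t \<ge> 2"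
  shows "I2 m \<kappa> t \<noteq> {} \<longleftrightarrow> 2 * sqrt 2 \<le> sqrt m * \<kappa> * (1 / sqrt (real t - 1) - 1 / sqrt t)"
proof -
  define x y w M where "x = 1 / sqrt (real t - 1)" and "y = 1 / sqrt t" and "w = 1 / sqrt 2"
    and "M = sqrt m"
  have xy: "x > 0" "y > 0" "M > 0" using assms by (auto simp: x_def y_def M_def)
  have sq: "M * M = m" "x * x = 1 / (real t - 1)" "y * y = 1 / t" "w > 0" "2 * sqrt 2 = 4 * w"
    using assms by (auto simp: M_def x_def y_def w_def field_simps)
  have s2: "sqrt (2 * real t - 2) = sqrt 2 * sqrt (real t - 1)"
    by (simp add: real_sqrt_mult[symmetric] algebra_simps)
  have coeff: "0 \<le> M * (x + y) / 4" "\<not> M * (x + y) / 4 \<le> 0" using xy by (auto simp: not_le)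
  have "I2 m \<kappa> t \<noteq> {} \<longleftrightarrow> M * M * \<kappa> / 4 * (y * y) + M * w * y \<le> M * M * \<kappa> / 4 * (x * x) - M * w * x"
    using assms s2 unfolding sq(1-3)
    by (simp add: I2_def Let_def x_def y_def w_def M_def real_sqrt_mult)
  also have "\<dots> \<longleftrightarrow> 0 \<le> (M * (x + y) / 4) * (M * \<kappa> * (x - y) - 4 * w)"
  proof -
    have "(M * (x + y) / 4) * (M * \<kappa> * (x - y) - 4 * w) =
       (M * M * \<kappa> / 4 * (x * x) - M * w * x) - (M * M * \<kappa> / 4 * (y * y) + M * w * y)"
      by (simp add: field_simps)
    thus ?thesis by linarith
  qed
  also have "\<dots> \<longleftrightarrow> 4 * w \<le> M * \<kappa> * (x - y)"
    by (simp only: zero_le_mult_iff[of "M * (x + y) / 4"] coeff simp_thms diff_ge_0_iff_ge)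
  finally show ?thesis by (simp add: sq(5) x_def y_def M_def)
qed

text \<open>For x = 1 / sqrt (t - 2) and y = 1 / sqrt t, right endpoint minus left endpoint factors
  as M (x + y) times M \<kappa> (x - y) - 2, with M = sqrt m.\<close>

lemma I3_nonempty_iff:
  fixes m \<kappa> t :: nat
  assumes "m > 0" "t \<ge> 3"
  shows "I3 m \<kappa> t \<noteq> {} \<longleftrightarrow> 2 \<le> sqrt m * \<kappa> * (1 / sqrt (real t - 2) - 1 / sqrt t)"
proof -
  define x y M where "x = 1 / sqrt (real t - 2)" and "y = 1 / sqrt t" and "M = sqrt m"
  have xy: "x > 0" "y > 0" "M > 0" using assms by (auto simp: x_def y_def M_def)
  have sq: "M * M = m" "x * x = 1 / (real t - 2)" "y * y = 1 / t"
    using assms by (auto simp: M_def x_def y_def field_simps)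
  have coeff: "0 \<le> M * (x + y)" "\<not> M * (x + y) \<le> 0" using xy by (auto simp: not_le)
  have "I3 m \<kappa> t \<noteq> {} \<longleftrightarrow> M * M * \<kappa> * (y * y) + 2 * M * y \<le> M * M * \<kappa> * (x * x) - 2 * M * x"
    using assms unfolding sq by (simp add: I3_def Let_def x_def y_def M_def)
  also have "\<dots> \<longleftrightarrow> 0 \<le> (M * (x + y)) * (M * \<kappa> * (x - y) - 2)"
  proof -
    have "(M * (x + y)) * (M * \<kappa> * (x - y) - 2) =
       (M * M * \<kappa> * (x * x) - 2 * M * x) - (M * M * \<kappa> * (y * y) + 2 * M * y)"
      by (simp add: field_simps)
    thus ?thesis by linarith
  qed
  also have "\<dots> \<longleftrightarrow> 2 \<le> M * \<kappa> * (x - y)"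
    by (simp only: zero_le_mult_iff[of "M * (x + y)"] coeff simp_thms diff_ge_0_iff_ge)
  finally show ?thesis by (simp add: x_def y_def M_def)
qed

text \<open>With u = sqrt t and v = sqrt (t - 1) the last factor of the bound is (u + v)^2, so the
  bound is 8 (u v (u + v))^2 / \<kappa>^2. Since u - v = 1 / (u + v), also 1/v - 1/u = 1 / (u v (u +
  v)), and the bound becomes the criterion for \<open>I2\<close>. The criterion for
  \<open>I3\<close> is weaker: 2 replaces 2 sqrt 2, and t - 2 replaces t - 1.\<close>

lemma I2_I3_nonempty:
  fixes m \<kappa> t :: nat
  assumes pos: "m > 0" "\<kappa> > 0" "t > 0"
    and m: "real m \<ge> 8 * real t * (real t - 1) * (2 * real t - 1 + 2 * sqrt (real t * (real t - 1))) / (real \<kappa>)\<^sup>2"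
  shows "I2 m \<kappa> t \<noteq> {}" "I3 m \<kappa> t \<noteq> {}"
proof -
  have main: "2 * sqrt 2 \<le> sqrt m * \<kappa> * (1 / sqrt (real t - 1) - 1 / sqrt t)" if t: "t \<ge> 2"
  proof -
    define u v where "u = sqrt t" and "v = sqrt (real t - 1)"
    have u: "u > 0" "v > 0" "u * u = t" "v * v = real t - 1" using t by (auto simp: u_def v_def)
    have uv: "sqrt (real t * (real t - 1)) = u * v" by (simp add: u_def v_def real_sqrt_mult)
    have "8 * (u * u) * (v * v) * (u * u + v * v + 2 * (u * v)) \<le> real m * (real \<kappa>)\<^sup>2"
      using m pos unfolding uv u by (simp add: field_simps)
    moreover have "8 * (u * u) * (v * v) * (u * u + v * v + 2 * (u * v)) = 8 * (u * v * (u + v))\<^sup>2"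
      by (simp add: power2_eq_square algebra_simps)
    moreover have "sqrt (8 * (u * v * (u + v))\<^sup>2) = 2 * sqrt 2 * (u * v * (u + v))"
      using u real_sqrt_mult[of 4 2] by (simp add: real_sqrt_mult)
    moreover have "sqrt (real m * (real \<kappa>)\<^sup>2) = sqrt m * \<kappa>" by (simp add: real_sqrt_mult)
    ultimately have le: "2 * sqrt 2 * (u * v * (u + v)) \<le> sqrt m * \<kappa>"
      by (metis real_sqrt_le_mono)
    have "(u + v) * (u - v) = 1" using u by (simp add: algebra_simps)
    hence "u - v = 1 / (u + v)" using u by (simp add: nonzero_eq_divide_eq mult.commute)
    moreover have "1 / v - 1 / u = (u - v) / (u * v)" using u by (simp add: field_simps)
    ultimately have eq: "1 / v - 1 / u = 1 / (u * v * (u + v))" by simp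
    have "0 < u * v * (u + v)" using u by simp
    hence "2 * sqrt 2 \<le> sqrt m * \<kappa> * (1 / (u * v * (u + v)))" using le by (simp add: pos_le_divide_eq)
    thus ?thesis unfolding u_def[symmetric] v_def[symmetric] eq .
  qed
  show "I2 m \<kappa> t \<noteq> {}"
  proof (cases "t = 1")
    case False
    thus ?thesis using main pos by (subst I2_nonempty_iff) auto
  qed (simp add: I2_def Let_def)
  show "I3 m \<kappa> t \<noteq> {}"
  proof (cases "t \<in> {1, 2}")
    case False
    hence t: "t \<ge> 3" using pos by auto
    have "2 \<le> 2 * sqrt 2" by simp
    also have "\<dots> \<le> sqrt m * \<kappa> * (1 / sqrt (real t - 1) - 1 / sqrt t)" using main t by simp
    also have "\<dots> \<le> sqrt m * \<kappa> * (1 / sqrt (real t - 2) - 1 / sqrt t)"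
      using t by (intro mult_left_mono diff_right_mono divide_left_mono) auto
    finally show ?thesis using t pos by (subst I3_nonempty_iff) auto
  qed (auto simp: I3_def Let_def)
qed

text \<open>For t >= 2 the difference of inverse roots is at most 1, so the criterion gives sqrt m *
  \<kappa> >= 2 sqrt 2. It serves to force t = 1 when m \<kappa>^2 is below 4.\<close>

lemma I2_nonempty_imp:
  assumes "I2 m \<kappa> t \<noteq> {}" "m > 0" "t > 0"
  shows "t = 1 \<or> 8 \<le> real m * (real \<kappa>)\<^sup>2"
proof (rule disjCI)
  assume small: "\<not> 8 \<le> real m * (real \<kappa>)\<^sup>2"
  show "t = 1"
  proof (rule ccontr)
    assume "t \<noteq> 1"
    hence t: "t \<ge> 2" using assms(3) by simp
    have "1 / sqrt (real t - 1) \<le> 1" using t by (simp add: field_simps)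
    hence "1 / sqrt (real t - 1) - 1 / sqrt t \<le> 1"
      using t by (smt (verit) divide_nonneg_nonneg real_sqrt_ge_zero of_nat_0_le_iff)
    hence "sqrt m * \<kappa> * (1 / sqrt (real t - 1) - 1 / sqrt t) \<le> sqrt m * \<kappa>"
      by (intro mult_left_le) auto
    moreover have "2 * sqrt 2 \<le> sqrt m * \<kappa> * (1 / sqrt (real t - 1) - 1 / sqrt t)"
      using I2_nonempty_iff[of m t \<kappa>] assms t by simp
    ultimately have "2 * sqrt 2 \<le> sqrt m * \<kappa>" by linarith
    hence "(2 * sqrt 2)\<^sup>2 \<le> (sqrt m * \<kappa>)\<^sup>2" by (intro power_mono) auto
    thus False using small by (simp add: power_mult_distrib)
  qed
qed

section \<open>Subfields of the reals\<close>

lemma real_ring_simps: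
  "carrier real_ring = UNIV" "\<one>\<^bsub>real_ring\<^esub> = 1" "\<zero>\<^bsub>real_ring\<^esub> = 0"
  "x \<oplus>\<^bsub>real_ring\<^esub> y = x + y" "x \<otimes>\<^bsub>real_ring\<^esub> y = x * y"
  by (simp_all add: ring_of_type_algebra_def)

lemma real_ring_uminus: "\<ominus>\<^bsub>real_ring\<^esub> x = - x"
proof -
  interpret cring real_ring by (rule cring_from_type_algebra)
  show ?thesis by (rule minus_equality) (simp_all add: real_ring_simps)
qed

lemma real_ring_inverse: "x \<noteq> 0 \<Longrightarrow> inv\<^bsub>real_ring\<^esub> x = inverse x"
proof -
  interpret cring real_ring by (rule cring_from_type_algebra)
  show "x \<noteq> 0 \<Longrightarrow> inv\<^bsub>real_ring\<^esub> x = inverse x"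
    by (rule comm_inv_char) (simp_all add: real_ring_simps)
qed

context
  fixes H :: "real set"
begin

lemma generate_field_real:
  shows "1 \<in> generate_field real_ring H"
    and "x \<in> H \<Longrightarrow> x \<in> generate_field real_ring H"
    and "x \<in> generate_field real_ring H \<Longrightarrow> x \<noteq> 0 \<Longrightarrow> inverse x \<in> generate_field real_ring H"
    and "x \<in> generate_field real_ring H \<Longrightarrow> y \<in> generate_field real_ring H \<Longrightarrow> x + y \<in> generate_field real_ring H"
    and "x \<in> generate_field real_ring H \<Longrightarrow> y \<in> generate_field real_ring H \<Longrightarrow> x * y \<in> generate_field real_ring H"
  using generate_field.one[of real_ring H] generate_field.incl[of x H real_ring]
    generate_field.m_inv[of x real_ring H] generate_field.eng_add[of x real_ring H y]
    generate_field.eng_mult[of x real_ring H y]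
  by (simp_all add: real_ring_simps real_ring_inverse)

lemma of_nat_generate_field_real: "real n \<in> generate_field real_ring H"
proof (induction n)
  case 0
  have "- 1 \<in> generate_field real_ring H"
    using generate_field.a_inv[OF generate_field.one[of real_ring H]]
    by (simp add: real_ring_simps real_ring_uminus)
  from generate_field_real(4)[OF generate_field_real(1) this] show ?case by simp
qed (use generate_field_real in auto)

end

context biquadratic
begin

text \<open>The product of \<open>x\<close> with its three other conjugates is a rational norm
  \<open>N\<close>, nonzero by linear independence, so the inverse is that product of conjugates
  divided by \<open>N\<close>.\<close>

lemma rational_span_inverse:
  assumes "x \<in> rational_span" "x \<noteq> 0" shows "inverse x \<in> rational_span"
proof -
  obtain a b c d where r: "a \<in> \<rat>" "b \<in> \<rat>" "c \<in> \<rat>" "d \<in> \<rat>" "x = comb a b c d"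
    using assms(1) by (rule rational_spanE)
  define x\<^sub>1 x\<^sub>2 x\<^sub>3 where "x\<^sub>1 = comb a (- b) c (- d)"
    and "x\<^sub>2 = comb a b (- c) (- d)" and "x\<^sub>3 = comb a (- b) (- c) d"
  note x_defs = x\<^sub>1_def x\<^sub>2_def x\<^sub>3_def
  have span: "x\<^sub>1 \<in> rational_span" "x\<^sub>2 \<in> rational_span" "x\<^sub>3 \<in> rational_span"
    unfolding x_defs using r by (auto intro!: rational_spanI)
  have "\<not> (a = 0 \<and> b = 0 \<and> c = 0 \<and> d = 0)" using r(5) assms(2) by (auto simp: comb_def)
  hence "x\<^sub>1 \<noteq> 0" "x\<^sub>2 \<noteq> 0" "x\<^sub>3 \<noteq> 0"
    using comb_eq_0[of a "- b" c "- d"] comb_eq_0[of a b "- c" "- d"] comb_eq_0[of a "- b" "- c" d]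
      r(1-4) by (auto simp only: x_defs neg_equal_0_iff_equal Rats_minus_iff)
  \<comment> \<open>u + v Q is the relative norm of \<open>x\<close> to the field of
    \<open>Q\<close>, and \<open>N\<close> is the norm of that to the rationals.\<close>
  define u v N where "u = a * a + c * c * (q\<^sub>0 * g) - b * b * (p\<^sub>0 * g) - d * d * (p\<^sub>0 * q\<^sub>0)"
    and "v = 2 * a * c - 2 * b * d * p\<^sub>0" and "N = u * u - v * v * (q\<^sub>0 * g)"
  have "x * x\<^sub>1 = a * a + c * c * (Q * Q) - b * b * (P * P) - d * d * (R * R) + 2 * a * c * Q - 2 * b * d * (P * R)"
    "x\<^sub>2 * x\<^sub>3 = a * a + c * c * (Q * Q) - b * b * (P * P) - d * d * (R * R) - 2 * a * c * Q + 2 * b * d * (P * R)"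
    by (simp_all add: r(5) x_defs comb_def algebra_simps)
  hence "x * x\<^sub>1 = u + v * Q" "x\<^sub>2 * x\<^sub>3 = u - v * Q"
    unfolding mults by (simp_all add: u_def v_def algebra_simps)
  hence "(x * x\<^sub>1) * (x\<^sub>2 * x\<^sub>3) = u * u - v * v * (Q * Q)"
    by (simp only:) (simp add: algebra_simps)
  hence N: "x * (x\<^sub>1 * (x\<^sub>2 * x\<^sub>3)) = N" unfolding mults N_def by simp
  hence "N \<noteq> 0" using assms(2) \<open>x\<^sub>1 \<noteq> 0\<close> \<open>x\<^sub>2 \<noteq> 0\<close> \<open>x\<^sub>3 \<noteq> 0\<close> by auto
  have "N \<in> \<rat>" using r by (auto simp: N_def u_def v_def)
  have "inverse x = (x\<^sub>1 * (x\<^sub>2 * x\<^sub>3)) * inverse N"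
    using \<open>N \<noteq> 0\<close> assms(2) N by (simp add: field_simps)
  also have "\<dots> \<in> rational_span"
    using \<open>N \<in> \<rat>\<close> by (intro rational_span_mult span Rats_rational_span[OF Rats_inverse])
  finally show ?thesis .
qed

lemma generate_field_rational_span: "generate_field real_ring {P, Q} \<subseteq> rational_span"
proof
  fix x assume "x \<in> generate_field real_ring {P, Q}"
  thus "x \<in> rational_span"
  proof induction
    case one
    show ?case by (simp add: real_ring_simps Rats_rational_span)
  next
    case (incl h)
    thus ?case using rational_spanI[of 0 1 0 0] rational_spanI[of 0 0 1 0] by (auto simp: comb_def)
  next
    case (a_inv h)
    thus ?case using rational_span_mult[OF Rats_rational_span[of "- 1"]]
      by (simp add: real_ring_uminus)
  next
    case (m_inv h)
    thus ?case by (simp add: real_ring_simps real_ring_inverse rational_span_inverse)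
  qed (simp_all add: real_ring_simps rational_span_add rational_span_mult)
qed

end

section \<open>Representations as sums of squares\<close>

text \<open>The finite remainder of the case D \<noteq> 0, where t = 1 and \<open>lower\<close> is
  the left endpoint of \<open>I3\<close>. Smallness and oddness leave \<kappa> = 1 and m = 1 or 3,
  and then q is confined to a short range.\<close>

lemma small_radicand_false:
  fixes m \<kappa> q r :: nat
  assumes pos: "m > 0" "\<kappa> > 0" and small: "real m * (real \<kappa>)\<^sup>2 < 4" and "odd (m * \<kappa>)"
    and lower: "real (m * \<kappa>) + 2 * sqrt m \<le> sqrt q"
    and r: "q < r" "real r < 2 * real (m * \<kappa>) * sqrt q + 4 * m" "real r < 16 * m"
    and q: "q mod 4 = 1" "squarefree q"
  shows False
proof -
  have "m * \<kappa>\<^sup>2 < 4" using small by (metis of_nat_less_iff of_nat_mult of_nat_numeral of_nat_power)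
  have "\<kappa> = 1"
  proof (rule ccontr)
    assume "\<kappa> \<noteq> 1"
    hence "2\<^sup>2 \<le> \<kappa>\<^sup>2" using pos by (intro power_mono) auto
    hence "1 * 4 \<le> m * \<kappa>\<^sup>2" using pos by (intro mult_mono) auto
    thus False using \<open>m * \<kappa>\<^sup>2 < 4\<close> by simp
  qed
  hence "m < 4" "odd m" using \<open>m * \<kappa>\<^sup>2 < 4\<close> assms(4) by auto
  hence "m = 1 \<or> m = 3" using pos by presburger
  moreover have False if "m = 1"
  proof -
    have s: "sqrt q \<ge> 3" using lower that \<open>\<kappa> = 1\<close> by simp
    have "sqrt q * sqrt q = q" by simp
    \<comment> \<open>The constant drops from 4 to 3 because q < r are integers, so q + 1 <= r; with
      4 the boundary sqrt q = 3 would survive.\<close>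
    hence "sqrt q * sqrt q < 2 * sqrt q + 3" using r(1,2) that \<open>\<kappa> = 1\<close> by simp
    moreover have "3 * sqrt q \<le> sqrt q * sqrt q" using s by (intro mult_right_mono) auto
    ultimately show False using s by linarith
  qed
  moreover have False if "m = 3"
  proof -
    have s: "3 + 2 * sqrt 3 \<le> sqrt q" using lower that \<open>\<kappa> = 1\<close> by simp
    have "(17 / 10 :: real) \<le> sqrt 3" by (rule real_le_rsqrt) (simp add: power2_eq_square)
    hence "(64 / 10 :: real) \<le> sqrt q" using s by linarith
    hence "(64 / 10 :: real)\<^sup>2 \<le> (sqrt q)\<^sup>2" by (intro power_mono) auto
    hence "q > 40" by (simp add: power2_eq_square)
    moreover have "q < 47" using r that by simp
    ultimately have "q = 41 \<or> q = 45" using q(1) by presburger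
    moreover have "q \<noteq> 41"
    proof
      assume "q = 41"
      \<comment> \<open>The earlier estimate 17/10 yields only 6.4^2 = 40.96; here 6.46^2 exceeds
        41.\<close>
      have "(173 / 100 :: real) \<le> sqrt 3" by (rule real_le_rsqrt) (simp add: power2_eq_square)
      hence "(646 / 100 :: real) \<le> sqrt q" using s by linarith
      hence "(646 / 100 :: real)\<^sup>2 \<le> (sqrt q)\<^sup>2" by (intro power_mono) auto
      thus False using \<open>q = 41\<close> by (simp add: power2_eq_square)
    qed
    moreover have "q \<noteq> 45"
    proof
      assume "q = 45"
      hence "(3::nat)\<^sup>2 dvd q" by simp
      hence "(3::nat) dvd 1" using q(2) by (simp only: squarefree_def)
      thus False by simp
    qed
    ultimately show False by blast
  qed
  ultimately show False by blast
qed

text \<open>\<open>T\<close> stands for the trace of m \<alpha> and \<open>k\<close> for m \<kappa>.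
  The term in \<open>D\<close> alone contributes at least R^2. If R >= 4 sqrt m, then |B P| >= R - 2
  sqrt m >= 2 sqrt m, so T >= R^2 + 4m >= 2 k Q + 4m, against the upper bound.\<close>

lemma nonzero_last_coordinate_bound:
  fixes P Q R B D T k m :: real
  assumes pos: "0 \<le> Q" "Q < R" "0 \<le> m" "0 \<le> k" "2 * k \<le> R" and D: "1 \<le> \<bar>D\<bar>"
    and T: "B\<^sup>2 * P\<^sup>2 + D\<^sup>2 * R\<^sup>2 \<le> T" "T < 2 * k * Q + 4 * m"
    and diff: "(B * P - D * R)\<^sup>2 < 4 * m"
  shows "R < 4 * sqrt m" "R\<^sup>2 < 2 * k * Q + 4 * m"
proof -
  have D2: "1 \<le> D\<^sup>2" using power_mono[OF D, of 2] by simp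
  have R0: "R > 0" using pos by simp
  have "1 * R\<^sup>2 \<le> D\<^sup>2 * R\<^sup>2" using D2 by (intro mult_right_mono) auto
  hence RT: "R\<^sup>2 \<le> D\<^sup>2 * R\<^sup>2" by simp
  thus "R\<^sup>2 < 2 * k * Q + 4 * m" using T by (smt (verit) zero_le_power2 mult_nonneg_nonneg)
  show "R < 4 * sqrt m"
  proof (rule ccontr)
    assume "\<not> R < 4 * sqrt m"
    hence R4: "4 * sqrt m \<le> R" by simp
    define s where "s = sqrt m"
    have s: "s \<ge> 0" "s\<^sup>2 = m" using pos by (auto simp: s_def)
    have "(B * P - D * R)\<^sup>2 < (2 * s)\<^sup>2" using diff s by (simp add: power_mult_distrib)
    hence "\<bar>B * P - D * R\<bar> < 2 * s" using s by (metis abs_le_square_iff abs_of_nonneg linorder_not_less mult_nonneg_nonneg zero_le_numeral)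
    moreover have "1 * R \<le> \<bar>D\<bar> * R" using D R0 by (intro mult_right_mono) auto
    hence "R \<le> \<bar>D * R\<bar>" using R0 by (simp add: abs_mult)
    ultimately have "R - 2 * s \<le> \<bar>B * P\<bar>" by linarith
    moreover have R2: "2 * s \<le> R - 2 * s" using R4 s_def by simp
    ultimately have "(R - 2 * s)\<^sup>2 \<le> (\<bar>B * P\<bar>)\<^sup>2" using s by (intro power_mono) auto
    hence "(R - 2 * s)\<^sup>2 \<le> B\<^sup>2 * P\<^sup>2" by (simp add: power_mult_distrib)
    moreover have "(2 * s)\<^sup>2 \<le> (R - 2 * s)\<^sup>2" using s R2 by (intro power_mono) auto
    hence "4 * m \<le> (R - 2 * s)\<^sup>2" using s(2) by (simp add: power_mult_distrib)
    moreover have "2 * k * Q \<le> R * Q" using pos by (intro mult_right_mono) auto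
    moreover have "R * Q \<le> R\<^sup>2" using pos R0 by (simp add: power2_eq_square)
    ultimately show False using T RT by linarith
  qed
qed

section \<open>The concrete field and the test element\<close>

lemma biquadratic_sqrt:
  fixes p q r :: nat
  assumes "2 \<le> p" "2 \<le> q" "squarefree p" "squarefree q" "r = p * q div (gcd p q)\<^sup>2" "q < r"
  defines "g \<equiv> gcd p q" and "p\<^sub>0 \<equiv> p div gcd p q" and "q\<^sub>0 \<equiv> q div gcd p q"
  shows "p = p\<^sub>0 * g" "q = q\<^sub>0 * g" "r = p\<^sub>0 * q\<^sub>0" "squarefree r"
    "biquadratic p\<^sub>0 q\<^sub>0 g (sqrt p) (sqrt q) (sqrt r)"
proof -
  have g: "g > 0" using assms(1) by (simp add: g_def)
  show p: "p = p\<^sub>0 * g" and q: "q = q\<^sub>0 * g" by (simp_all add: p\<^sub>0_def q\<^sub>0_def g_def)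
  have "p * q = p\<^sub>0 * q\<^sub>0 * g\<^sup>2" by (subst p, subst q) (simp add: power2_eq_square)
  thus r: "r = p\<^sub>0 * q\<^sub>0" using g assms(5) by (simp add: g_def[symmetric])
  have pos: "p\<^sub>0 > 0" "q\<^sub>0 > 0" using p q assms(1,2) by (auto intro: gr0I)
  have "coprime p\<^sub>0 q\<^sub>0" using assms(1) unfolding p\<^sub>0_def q\<^sub>0_def by (intro div_gcd_coprime) auto
  moreover have "squarefree p\<^sub>0" "squarefree q\<^sub>0"
    using assms(3,4) p q squarefree_multD(1) by metis+
  ultimately show sqf: "squarefree r" unfolding r by (intro squarefree_mult_coprime)
  have pqr: "sqrt p = sqrt p\<^sub>0 * sqrt g" "sqrt q = sqrt q\<^sub>0 * sqrt g" "sqrt r = sqrt p\<^sub>0 * sqrt q\<^sub>0"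
    by (subst p q r, simp add: real_sqrt_mult)+
  have irr: "sqrt p \<notin> \<rat>" "sqrt q \<notin> \<rat>" "sqrt r \<notin> \<rat>"
    using sqrt_not_Rats[of p] sqrt_not_Rats[of q] sqrt_not_Rats[of r] assms(1-4,6) sqf by simp_all
  have sq: "sqrt x * (sqrt x * y) = x * y" for x :: nat and y by (simp add: mult.assoc[symmetric])
  show "biquadratic p\<^sub>0 q\<^sub>0 g (sqrt p) (sqrt q) (sqrt r)"
  proof
    show "sqrt p * sqrt p = p\<^sub>0 * g" "sqrt q * sqrt q = q\<^sub>0 * g" "sqrt r * sqrt r = p\<^sub>0 * q\<^sub>0"
      using p q r by simp_all
    show "sqrt p * sqrt q = g * sqrt r" "sqrt p * sqrt r = p\<^sub>0 * sqrt q" "sqrt q * sqrt r = q\<^sub>0 * sqrt p"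
      unfolding pqr by (simp_all add: mult_ac sq)
  qed (use pos g irr in auto)
qed

text \<open>The element is a root of X^2 - (2n + \<kappa>) X + n^2 + \<kappa> n - \<kappa>^2 j with
  q = 4j + 1, which is \<open>f\<close> in the proof.\<close>

lemma totally_positive_integer_half:
  fixes q \<kappa> n :: nat
  assumes K: "sqrt q \<in> H" and q: "q mod 4 = 1" and pos: "real \<kappa> * sqrt q < 2 * n + \<kappa>"
  shows "n + \<kappa> * (1 + sqrt q) / 2 \<in> totally_positive_integers (generate_field real_ring H)"
proof -
  define K where "K = generate_field real_ring H"
  define \<alpha> where "\<alpha> = n + \<kappa> * (1 + sqrt q) / 2"
  note gf = generate_field_real[where H = H, folded K_def]
  have nat: "real i \<in> K" for i unfolding K_def by (rule of_nat_generate_field_real)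
  have sq: "sqrt q \<in> K" using K gf by simp
  have "inverse 2 \<in> K" using gf(3)[OF nat[of 2]] by simp
  hence "n + \<kappa> * (1 + sqrt q) * inverse 2 \<in> K" by (intro gf(1,4,5) nat sq)
  hence \<alpha>: "\<alpha> \<in> K" by (simp add: \<alpha>_def field_simps)
  obtain j where j: "q = 4 * j + 1" using q by (metis div_mult_mod_eq mult.commute)
  define f where "f = [: real n * n + real \<kappa> * n - real \<kappa> * \<kappa> * j, - (2 * real n + \<kappa>), 1 :]"
  have "poly f \<alpha> = 0"
  proof -
    define s where "s = sqrt q"
    have ss: "s * s = 4 * j + 1" by (simp add: s_def j)
    have "poly f \<alpha> = \<kappa> * \<kappa> * (s * s - (4 * j + 1)) / 4"
      by (simp add: f_def \<alpha>_def s_def[symmetric] field_simps)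
    thus ?thesis using ss by simp
  qed
  moreover have "coeff f i \<in> \<int>" for i
    by (auto simp: f_def coeff_pCons split: nat.splits)
  ultimately have "algebraic_int \<alpha>" by (intro algebraic_int.intros[of f]) (auto simp: f_def)
  moreover have "\<sigma> \<alpha> > 0" if "\<sigma> \<in> real_embeddings K" for \<sigma>
  proof -
    have hom: "\<sigma> 1 = 1" "\<And>x y. x \<in> K \<Longrightarrow> y \<in> K \<Longrightarrow> \<sigma> (x + y) = \<sigma> x + \<sigma> y"
      "\<And>x y. x \<in> K \<Longrightarrow> y \<in> K \<Longrightarrow> \<sigma> (x * y) = \<sigma> x * \<sigma> y"
      using that unfolding real_embeddings_def ring_hom_def by (auto simp: real_ring_simps)
    have "\<sigma> 0 = 0" using hom(2)[of 0 0] nat[of 0] by simp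
    hence hnat: "\<sigma> (real i) = real i" for i
      using hom(2)[OF nat[of 1] nat] by (induction i) (simp_all add: hom(1))
    \<comment> \<open>An embedding is given only as a ring homomorphism, but the square of its value
      at sqrt q is q. So that value is at least - sqrt q, and \<open>pos\<close> covers this worst
      case.\<close>
    have "(\<sigma> (sqrt q))\<^sup>2 = q" using hom(3)[OF sq sq] hnat[of q] by (simp add: power2_eq_square)
    hence "\<bar>\<sigma> (sqrt q)\<bar> = sqrt q" by (metis real_sqrt_abs)
    hence "- sqrt q \<le> \<sigma> (sqrt q)" by linarith
    hence "\<kappa> * (- sqrt q) \<le> \<kappa> * \<sigma> (sqrt q)" by (intro mult_left_mono) auto
    moreover have "\<sigma> \<alpha> + \<sigma> \<alpha> = real (2 * n + \<kappa>) + \<kappa> * \<sigma> (sqrt q)"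
    proof -
      have double: "\<alpha> + \<alpha> = real (2 * n + \<kappa>) + \<kappa> * sqrt q"
        unfolding \<alpha>_def by (simp add: distrib_left)
      have "\<sigma> \<alpha> + \<sigma> \<alpha> = \<sigma> (\<alpha> + \<alpha>)" by (simp only: hom(2)[OF \<alpha> \<alpha>])
      also have "\<dots> = \<sigma> (real (2 * n + \<kappa>)) + \<sigma> (\<kappa> * sqrt q)"
        unfolding double by (rule hom(2)[OF nat gf(5)[OF nat sq]])
      finally show ?thesis by (simp only: hnat hom(3)[OF nat sq])
    qed
    ultimately show ?thesis using pos by simp
  qed
  ultimately show ?thesis using \<alpha>
    unfolding totally_positive_integers_def ring_of_integers_def K_def[symmetric] \<alpha>_def[symmetric] by blast
qed

section \<open>Comparison of coordinates\<close>

context biquadratic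
begin

lemma sum_of_squares_coordinates:
  fixes m \<kappa> k :: nat
  assumes sqf: "squarefree (p\<^sub>0 * g)" "squarefree (q\<^sub>0 * g)" "squarefree (p\<^sub>0 * q\<^sub>0)"
    and mod: "int (p\<^sub>0 * g) mod 4 \<in> {2, 3}" "int (q\<^sub>0 * g) mod 4 = 1" "int (p\<^sub>0 * q\<^sub>0) mod 4 \<in> {2, 3}"
    and "m * (k + \<kappa> * (1 + Q) / 2) \<in> sums_of_squares (ring_of_integers (generate_field real_ring {P, Q}))"
  obtains n :: nat and A B C D :: "nat \<Rightarrow> int" where
    "\<And>i. i < n \<Longrightarrow> D i = 0 \<Longrightarrow> even (A i - C i)"
    "(\<Sum>i<n. (A i)\<^sup>2 + int (p\<^sub>0 * g) * (B i)\<^sup>2 + int (q\<^sub>0 * g) * (C i)\<^sup>2 + int (p\<^sub>0 * q\<^sub>0) * (D i)\<^sup>2)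
       = 4 * int (m * k) + 2 * int (m * \<kappa>)"
    "(\<Sum>i<n. A i * C i + int p\<^sub>0 * B i * D i) = int (m * \<kappa>)"
proof -
  have "\<exists>(n::nat) \<beta>. m * (k + \<kappa> * (1 + Q) / 2) = (\<Sum>i<n. (\<beta> i)\<^sup>2)
      \<and> (\<forall>i<n. \<beta> i \<in> ring_of_integers (generate_field real_ring {P, Q}))"
    using assms(7) by (simp add: sums_of_squares_def)
  then obtain n :: nat and \<beta> where \<beta>: "m * (k + \<kappa> * (1 + Q) / 2) = (\<Sum>i<n. (\<beta> i)\<^sup>2)"
    and mem: "\<forall>i<n. \<beta> i \<in> ring_of_integers (generate_field real_ring {P, Q})"
    by (elim exE conjE)
  have "\<exists>A B C D :: int. \<beta> i = comb (of_int A / 2) (of_int B / 2) (of_int C / 2) (of_int D / 2)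
          \<and> (D = 0 \<longrightarrow> even (A - C))" if i: "i < n" for i
  proof -
    have "\<beta> i \<in> rational_span" "algebraic_int (\<beta> i)"
      using mem i generate_field_rational_span by (auto simp: ring_of_integers_def)
    then obtain a b c d where "a \<in> \<rat>" "b \<in> \<rat>" "c \<in> \<rat>" "d \<in> \<rat>" "\<beta> i = comb a b c d"
      "algebraic_int (comb a b c d)" by (metis rational_spanE)
    thus ?thesis using algebraic_int_coordinates[OF sqf mod, of a b c d] by metis
  qed
  then obtain A B C D :: "nat \<Rightarrow> int" where
    coords: "\<And>i. i < n \<Longrightarrow> \<beta> i = comb (of_int (A i) / 2) (of_int (B i) / 2) (of_int (C i) / 2) (of_int (D i) / 2)"
    and parity: "\<And>i. i < n \<Longrightarrow> D i = 0 \<Longrightarrow> even (A i - C i)"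
    by metis
  \<comment> \<open>Four times the square of the i-th element is e1 + 2 e2 P + 2 e3 Q + 2 e4
    R.\<close>
  define e\<^sub>1 e\<^sub>2 e\<^sub>3 e\<^sub>4 where
    "e\<^sub>1 i = (A i)\<^sup>2 + int (p\<^sub>0 * g) * (B i)\<^sup>2 + int (q\<^sub>0 * g) * (C i)\<^sup>2 + int (p\<^sub>0 * q\<^sub>0) * (D i)\<^sup>2"
    and "e\<^sub>2 i = A i * B i + int q\<^sub>0 * C i * D i"
    and "e\<^sub>3 i = A i * C i + int p\<^sub>0 * B i * D i"
    and "e\<^sub>4 i = A i * D i + int g * B i * C i" for i
  have sq: "(\<beta> i)\<^sup>2 = comb (of_int (e\<^sub>1 i) / 4) (of_int (e\<^sub>2 i) / 2) (of_int (e\<^sub>3 i) / 2) (of_int (e\<^sub>4 i) / 2)"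
    if "i < n" for i
    unfolding coords[OF that] power2_eq_square[of "comb _ _ _ _"] comb_mult e\<^sub>1_def e\<^sub>2_def e\<^sub>3_def e\<^sub>4_def
    by (simp add: comb_def power2_eq_square field_simps)
  have "(\<Sum>i<n. (\<beta> i)\<^sup>2) = comb (of_int (sum e\<^sub>1 {..<n}) / 4) (of_int (sum e\<^sub>2 {..<n}) / 2)
          (of_int (sum e\<^sub>3 {..<n}) / 2) (of_int (sum e\<^sub>4 {..<n}) / 2)"
    by (simp add: sq comb_sum sum_divide_distrib)
  moreover have "m * (k + \<kappa> * (1 + Q) / 2) = comb (real (m * k) + real (m * \<kappa>) / 2) 0 (real (m * \<kappa>) / 2) 0"
    by (simp add: comb_def field_simps)
  ultimately have eq: "comb (of_int (sum e\<^sub>1 {..<n}) / 4) (of_int (sum e\<^sub>2 {..<n}) / 2)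
          (of_int (sum e\<^sub>3 {..<n}) / 2) (of_int (sum e\<^sub>4 {..<n}) / 2)
      = comb (real (m * k) + real (m * \<kappa>) / 2) 0 (real (m * \<kappa>) / 2) 0" using \<beta> by simp
  have "of_int (sum e\<^sub>1 {..<n}) / 4 = real (m * k) + real (m * \<kappa>) / 2"
    by (rule comb_cong(1)[OF _ _ _ _ _ _ _ _ eq]) (intro Rats_divide Rats_add Rats_of_int Rats_of_nat Rats_number_of Rats_0)+
  hence "real_of_int (sum e\<^sub>1 {..<n}) = of_int (4 * int (m * k) + 2 * int (m * \<kappa>))" by simp
  hence 1: "sum e\<^sub>1 {..<n} = 4 * int (m * k) + 2 * int (m * \<kappa>)" by linarith
  have "of_int (sum e\<^sub>3 {..<n}) / 2 = real (m * \<kappa>) / 2"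
    by (rule comb_cong(3)[OF _ _ _ _ _ _ _ _ eq]) (intro Rats_divide Rats_add Rats_of_int Rats_of_nat Rats_number_of Rats_0)+
  hence "real_of_int (sum e\<^sub>3 {..<n}) = of_int (int (m * \<kappa>))" by simp
  hence 3: "sum e\<^sub>3 {..<n} = int (m * \<kappa>)" by linarith
  show ?thesis by (rule that[where B = B, OF parity]) (use 1 3 in \<open>simp_all only: e\<^sub>1_def[abs_def] e\<^sub>3_def[abs_def]\<close>)
qed

text \<open>
  \<open>S i\<close> is the mean of the squares of the two conjugates of the \<open>i\<close>-th element that send \<open>Q\<close> to \<open>- Q\<close>
  (up to a factor 4); these sum to the small conjugate of the represented number.
\<close>

lemma coordinates_false:
  fixes A B C D :: "nat \<Rightarrow> int" and n m \<kappa> k t q r :: nat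
  assumes QR: "Q = sqrt q" "R = sqrt r" "q < r" "q mod 4 = 1" "squarefree q"
    and pos: "m > 0" "\<kappa> > 0" "t > 0" and "2 * real (m * \<kappa>) \<le> R" and par: "even (m * \<kappa> + t)"
    and I: "I2 m \<kappa> t \<noteq> {}" "Q \<in> I3 m \<kappa> t" and close: "2 * real k + \<kappa> < \<kappa> * Q + 2"
    and AC: "\<And>i. i < n \<Longrightarrow> D i = 0 \<Longrightarrow> even (A i - C i)"
    and norm: "(\<Sum>i<n. (A i)\<^sup>2 + int (p\<^sub>0 * g) * (B i)\<^sup>2 + int (q\<^sub>0 * g) * (C i)\<^sup>2 + int (p\<^sub>0 * q\<^sub>0) * (D i)\<^sup>2)
       = 4 * int (m * k) + 2 * int (m * \<kappa>)"
    and prod: "(\<Sum>i<n. A i * C i + int p\<^sub>0 * B i * D i) = int (m * \<kappa>)"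
  shows False
proof -
  have Q0: "Q > 0" using QR(1,4) by (cases "q = 0") auto
  define M T where "M = real (m * \<kappa>)" and "T = 4 * real (m * k) + 2 * M"
  define N where "N i = (of_int (A i))\<^sup>2 + (of_int (B i))\<^sup>2 * P\<^sup>2 + (of_int (C i))\<^sup>2 * Q\<^sup>2 + (of_int (D i))\<^sup>2 * R\<^sup>2" for i
  define S where "S i = (of_int (A i) - of_int (C i) * Q)\<^sup>2 + (of_int (B i) * P - of_int (D i) * R)\<^sup>2" for i
  have N: "(\<Sum>i<n. N i) = T"
  proof -
    have "(\<Sum>i<n. N i) = of_int (\<Sum>i<n. (A i)\<^sup>2 + int (p\<^sub>0 * g) * (B i)\<^sup>2 + int (q\<^sub>0 * g) * (C i)\<^sup>2 + int (p\<^sub>0 * q\<^sub>0) * (D i)\<^sup>2)"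
      unfolding N_def power2_eq_square[of P] power2_eq_square[of Q] power2_eq_square[of R] mults
      by (simp add: mult_ac)
    thus ?thesis unfolding norm by (simp add: T_def M_def)
  qed
  have S: "(\<Sum>i<n. S i) = T - 2 * Q * M"
  proof -
    have "S i = N i - 2 * Q * of_int (A i * C i + int p\<^sub>0 * B i * D i)" for i
    proof -
      have "S i = N i - 2 * Q * (of_int (A i) * of_int (C i)) - 2 * of_int (B i) * of_int (D i) * (P * R)"
        by (simp add: S_def N_def power2_eq_square algebra_simps)
      thus ?thesis unfolding mults by (simp add: algebra_simps)
    qed
    hence "(\<Sum>i<n. S i) = (\<Sum>i<n. N i) - 2 * Q * of_int (\<Sum>i<n. A i * C i + int p\<^sub>0 * B i * D i)"
      by (simp only: sum_subtractf sum_distrib_left[symmetric] of_int_sum)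
    thus ?thesis unfolding N prod by (simp add: M_def)
  qed
  \<comment> \<open>\<open>close\<close> says that the conjugate k + \<kappa> (1 - Q) / 2 is below
    1; the sum of all \<open>S i\<close> is 4m times this conjugate.\<close>
  have "m * (2 * real k + \<kappa>) < m * (\<kappa> * Q + 2)" using close pos by (intro mult_strict_left_mono) auto
  hence T: "T < 2 * M * Q + 4 * m" by (simp add: T_def M_def algebra_simps)
  hence S4: "(\<Sum>i<n. S i) < 4 * m" using S by (simp add: algebra_simps)
  have D0: "D i = 0" if i: "i < n" for i
  proof (rule ccontr)
    assume "D i \<noteq> 0"
    hence "1 \<le> \<bar>real_of_int (D i)\<bar>" by linarith
    moreover have "S i \<le> (\<Sum>i<n. S i)" using i by (intro member_le_sum) (auto simp: S_def)
    hence "(of_int (B i) * P - of_int (D i) * R)\<^sup>2 < 4 * m" using S4 by (simp add: S_def)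
       (smt (verit) zero_le_power2)
    moreover have "N i \<le> (\<Sum>i<n. N i)" using i by (intro member_le_sum) (auto simp: N_def)
    hence "(of_int (B i))\<^sup>2 * P\<^sup>2 + (of_int (D i))\<^sup>2 * R\<^sup>2 \<le> T"
      unfolding N by (simp add: N_def) (smt (verit) zero_le_power2 mult_nonneg_nonneg)
    ultimately have R: "R < 4 * sqrt m" "R\<^sup>2 < 2 * M * Q + 4 * m"
      using nonzero_last_coordinate_bound[of Q R m M "of_int (D i)" "of_int (B i)" P T] T Q0 QR assms(9)
      by (auto simp: M_def)
    \<comment> \<open>Combining 2M <= R < 4 sqrt m with M = sqrt m * (sqrt m * \<kappa>) gives m
      \<kappa>^2 < 4, below the threshold 8 that a nonempty \<open>I2\<close> demands for t >
      1.\<close>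
    have "2 * M < 4 * sqrt m" using R(1) assms(9)[folded M_def] by linarith
    moreover have "sqrt m * (sqrt m * \<kappa>) = M" by (simp add: M_def)
    ultimately have "sqrt m * (sqrt m * \<kappa>) < sqrt m * 2" by linarith
    hence "sqrt m * \<kappa> < 2" using pos by simp
    hence "(sqrt m * \<kappa>)\<^sup>2 < 2\<^sup>2" by (intro power_strict_mono) auto
    hence small: "real m * (real \<kappa>)\<^sup>2 < 4" by (simp add: power_mult_distrib)
    hence t: "t = 1" using I2_nonempty_imp[OF I(1) pos(1,3)] by linarith
    have "R\<^sup>2 < (4 * sqrt m)\<^sup>2" using R(1) QR by (intro power_strict_mono) auto
    hence "real r < 16 * m" using QR by (simp add: power_mult_distrib)
    moreover have "real (m * \<kappa>) + 2 * sqrt m \<le> sqrt q" using I(2) t QR by (simp add: I3_def Let_def)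
    ultimately show False
      using small_radicand_false[OF pos(1,2) small, of q r] par t R(2) QR by (simp add: M_def)
  qed
  define c where "c i = real_of_int (C i)" for i
  define e where "e i = real_of_int (A i) - c i * Q" for i
  define L where "L = nat (\<Sum>i<n. (C i)\<^sup>2)"
  have Lint: "int L = (\<Sum>i<n. (C i)\<^sup>2)" by (simp add: L_def sum_nonneg)
  have L: "real L = (\<Sum>i<n. (c i)\<^sup>2)" using arg_cong[OF Lint, of real_of_int] by (simp add: c_def)
  have prod': "(\<Sum>i<n. A i * C i) = int (m * \<kappa>)" using prod D0 by simp
  have "L > 0"
  proof (rule ccontr)
    assume "\<not> L > 0"
    hence "(\<Sum>i<n. (C i)\<^sup>2) = 0" using Lint by simp
    hence "\<And>i. i < n \<Longrightarrow> C i = 0" by (subst (asm) sum_nonneg_eq_0_iff) auto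
    hence "int (m * \<kappa>) = 0" unfolding prod'[symmetric] by simp
    thus False using pos by simp
  qed
  have parL: "even (L + t)"
  proof -
    have "even (\<Sum>i<n. (A i - C i) * C i)" using AC D0 by (intro dvd_sum) auto
    moreover have "(\<Sum>i<n. (A i - C i) * C i) = int (m * \<kappa>) - int L"
      unfolding Lint prod'[symmetric] by (simp add: sum_subtractf algebra_simps power2_eq_square)
    ultimately have "even (int (m * \<kappa>) - int L)" by simp
    hence "even (m * \<kappa> + L)" by presburger
    thus ?thesis using par by presburger
  qed
  have ec: "(\<Sum>i<n. c i * e i) = M - L * Q"
  proof -
    have "(\<Sum>i<n. c i * e i) = of_int (\<Sum>i<n. A i * C i) - (\<Sum>i<n. (c i)\<^sup>2) * Q"
      by (simp add: e_def c_def sum_subtractf sum_distrib_left algebra_simps power2_eq_square)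
    thus ?thesis unfolding prod' L M_def by simp
  qed
  have "(\<Sum>i<n. (e i)\<^sup>2) \<le> (\<Sum>i<n. S i)"
    by (intro sum_mono) (simp add: S_def e_def c_def)
  hence es: "(\<Sum>i<n. (e i)\<^sup>2) < 4 * m" using S4 by simp
  define F where "F = M - L * Q"
  \<comment> \<open>Cauchy--Schwarz for \<open>c\<close> and \<open>e\<close>\<close>
  have "0 \<le> (\<Sum>i<n. (L * e i - F * c i)\<^sup>2)" by (intro sum_nonneg) auto
  also have "\<dots> = L * L * (\<Sum>i<n. (e i)\<^sup>2) - 2 * L * F * (\<Sum>i<n. c i * e i) + F * F * (\<Sum>i<n. (c i)\<^sup>2)"
    by (simp add: sum_distrib_left sum.distrib sum_subtractf power2_eq_square algebra_simps)
  also have "\<dots> = L * (L * (\<Sum>i<n. (e i)\<^sup>2) - F\<^sup>2)"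
    unfolding ec L[symmetric] F_def[symmetric] by (simp add: power2_eq_square algebra_simps)
  finally have "F\<^sup>2 \<le> L * (\<Sum>i<n. (e i)\<^sup>2)" using \<open>L > 0\<close> by (simp add: zero_le_mult_iff)
  also have "\<dots> < real L * (4 * real m)" using es \<open>L > 0\<close> by (intro mult_strict_left_mono) auto
  finally have "sqrt (F\<^sup>2) < sqrt (real L * (4 * real m))" by (rule real_sqrt_less_mono)
  hence "\<bar>M - L * Q\<bar> < 2 * sqrt m * sqrt L" by (simp add: real_sqrt_mult F_def mult_ac)
  thus False
    using I3_excludes[OF pos(1,3) \<open>L > 0\<close> parL Q0 I(2)] by (simp add: M_def)
qed

end

theorem proposition5p1:
  fixes p q r m \<kappa> t :: nat and K :: "real set"
  assumes "2 \<le> p" and "2 \<le> q" and "squarefree p" and "squarefree q"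
    and "[p = 2] (mod 4) \<or> [p = 3] (mod 4)" and "[q = 1] (mod 4)"
    and "r = p * q div (gcd p q)\<^sup>2"
    and "p < q" and "q < r"
    and "K = biquadratic_field p q"
    and "m > 0" and "\<kappa> > 0" and "t > 0"
  shows "(real m \<le> Min {real r / (2 * of_int \<lceil>real \<kappa> * sqrt (real r)\<rceil>), real p, real q / 2} \<and>
          [m * \<kappa> = t] (mod 2) \<and>
          sqrt (real p) \<in> I2 m \<kappa> t \<and> sqrt (real q) \<in> I3 m \<kappa> t \<longrightarrow>
          \<not> (\<lambda>\<alpha>. real m * \<alpha>) ` totally_positive_integers K
              \<subseteq> sums_of_squares (ring_of_integers K)) \<and>
         (real m \<ge> 8 * real t * (real t - 1) * (2 * real t - 1 + 2 * sqrt (real t * (real t - 1)))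
                    / (real \<kappa>)\<^sup>2 \<longrightarrow>
          I2 m \<kappa> t \<noteq> {} \<and> I3 m \<kappa> t \<noteq> {})"
proof (intro conjI impI)
  assume large: "real m \<ge> 8 * real t * (real t - 1) * (2 * real t - 1 + 2 * sqrt (real t * (real t - 1)))
                    / (real \<kappa>)\<^sup>2"
  show "I2 m \<kappa> t \<noteq> {}" "I3 m \<kappa> t \<noteq> {}" using I2_I3_nonempty[OF assms(11-13) large] .
next
  assume hyps: "real m \<le> Min {real r / (2 * of_int \<lceil>real \<kappa> * sqrt (real r)\<rceil>), real p, real q / 2} \<and>
          [m * \<kappa> = t] (mod 2) \<and> sqrt (real p) \<in> I2 m \<kappa> t \<and> sqrt (real q) \<in> I3 m \<kappa> t"
  define g p\<^sub>0 q\<^sub>0 where "g = gcd p q" and "p\<^sub>0 = p div gcd p q" and "q\<^sub>0 = q div gcd p q"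
  note bq = biquadratic_sqrt[OF assms(1-4,7,9), folded g_def p\<^sub>0_def q\<^sub>0_def]
  interpret biquadratic p\<^sub>0 q\<^sub>0 g "sqrt p" "sqrt q" "sqrt r" by (rule bq(5))
  have p4: "p mod 4 = 2 \<or> p mod 4 = 3" and q4: "q mod 4 = 1" using assms(5,6) by (auto simp: cong_def)
  \<comment> \<open>The residue of r is read off from r g^2 = p q: g divides the odd number q, so
    g^2 is 1 modulo 4, as is q.\<close>
  have r4: "r mod 4 = p mod 4"
  proof -
    have "odd q" using q4 by presburger
    hence "odd (int g)" using bq(2) by auto
    hence "(int g)\<^sup>2 mod 4 = 1" by (simp add: square_mod_4)
    hence g4: "g\<^sup>2 mod 4 = 1" by (metis of_nat_power of_nat_mod of_nat_numeral of_nat_1 of_nat_eq_iff)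
    have "p * q = (p\<^sub>0 * g) * (q\<^sub>0 * g)" by (metis bq(1,2))
    hence "r * g\<^sup>2 = p * q" unfolding bq(3) by (simp only: power2_eq_square mult_ac)
    hence "(r * (g\<^sup>2 mod 4)) mod 4 = (p * (q mod 4)) mod 4" by (simp add: mod_mult_right_eq)
    thus ?thesis using g4 q4 by simp
  qed
  have sqf: "squarefree (p\<^sub>0 * g)" "squarefree (q\<^sub>0 * g)" "squarefree (p\<^sub>0 * q\<^sub>0)"
    using assms(3,4) bq(1-4) by simp_all
  have mod: "int (p\<^sub>0 * g) mod 4 \<in> {2, 3}" "int (q\<^sub>0 * g) mod 4 = 1" "int (p\<^sub>0 * q\<^sub>0) mod 4 \<in> {2, 3}"
    using p4 q4 r4 zmod_int[of p 4] zmod_int[of q 4] zmod_int[of r 4]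
    unfolding bq(1-3)[symmetric] by auto
  have K: "K = generate_field real_ring {sqrt p, sqrt q}" using assms(10) by (simp add: biquadratic_field_def)
  define s :: real where "s = sqrt q"
  define k where "k = nat \<lfloor>\<kappa> * (s - 1) / 2\<rfloor> + 1"
  have "s \<ge> 1" using assms(2) by (simp add: s_def)
  hence "\<kappa> * (s - 1) / 2 \<ge> 0" by simp
  hence k: "real k = of_int \<lfloor>\<kappa> * (s - 1) / 2\<rfloor> + 1" unfolding k_def by simp
  have above: "\<kappa> * s < 2 * k + \<kappa>"
  proof -
    have "\<kappa> * (s - 1) / 2 < k" unfolding k by linarith
    thus ?thesis by (simp add: algebra_simps)
  qed
  \<comment> \<open>The floor gives only the non-strict bound; equality would make s rational. The
    strictness is what later puts the sum of the \<open>S i\<close> strictly below 4m.\<close>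
  have below: "2 * real k + \<kappa> < \<kappa> * s + 2"
  proof -
    have "real k - 1 \<le> \<kappa> * (s - 1) / 2" unfolding k by linarith
    hence "2 * real k + \<kappa> \<le> \<kappa> * s + 2" by (simp add: algebra_simps)
    moreover have "2 * real k + \<kappa> \<noteq> \<kappa> * s + 2"
    proof
      assume "2 * real k + \<kappa> = \<kappa> * s + 2"
      hence "s = (2 * real k + \<kappa> - 2) / \<kappa>" using assms(12) by (simp add: field_simps)
      also have "\<dots> \<in> \<rat>" by simp
      finally show False using irrational(2) by (simp add: s_def)
    qed
    ultimately show ?thesis by simp
  qed
  define \<alpha> where "\<alpha> = k + \<kappa> * (1 + s) / 2"
  have "\<alpha> \<in> totally_positive_integers K"
    unfolding \<alpha>_def K s_def by (rule totally_positive_integer_half) (use q4 above in \<open>auto simp: s_def\<close>)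
  moreover have "m * \<alpha> \<notin> sums_of_squares (ring_of_integers K)"
  proof
    assume "m * \<alpha> \<in> sums_of_squares (ring_of_integers K)"
    hence "m * (k + \<kappa> * (1 + sqrt q) / 2) \<in>
        sums_of_squares (ring_of_integers (generate_field real_ring {sqrt p, sqrt q}))"
      by (simp add: \<alpha>_def s_def K)
    then obtain n and A B C D :: "nat \<Rightarrow> int" where *:
      "\<And>i. i < n \<Longrightarrow> D i = 0 \<Longrightarrow> even (A i - C i)"
      "(\<Sum>i<n. (A i)\<^sup>2 + int (p\<^sub>0 * g) * (B i)\<^sup>2 + int (q\<^sub>0 * g) * (C i)\<^sup>2 + int (p\<^sub>0 * q\<^sub>0) * (D i)\<^sup>2)
         = 4 * int (m * k) + 2 * int (m * \<kappa>)"
      "(\<Sum>i<n. A i * C i + int p\<^sub>0 * B i * D i) = int (m * \<kappa>)"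
      by (rule sum_of_squares_coordinates[OF sqf mod]) (rule that)
    have r0: "sqrt r > 0" using assms(9) by simp
    \<comment> \<open>The ceiling is relaxed to \<kappa> sqrt r; cancelling one factor sqrt r then
      turns the bound on m into 2 m \<kappa> <= sqrt r.\<close>
    have ceil: "0 < \<kappa> * sqrt r" "\<kappa> * sqrt r \<le> of_int \<lceil>\<kappa> * sqrt r\<rceil>" using assms(12) r0 by auto
    have "m \<le> r / (2 * of_int \<lceil>\<kappa> * sqrt r\<rceil>)" using hyps by simp
    hence "real m * (2 * real_of_int \<lceil>\<kappa> * sqrt r\<rceil>) \<le> r" using ceil by (simp add: pos_le_divide_eq)
    moreover have "m * (2 * (\<kappa> * sqrt r)) \<le> real m * (2 * real_of_int \<lceil>\<kappa> * sqrt r\<rceil>)"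
      using ceil by (intro mult_left_mono) auto
    moreover have "m * (2 * (\<kappa> * sqrt r)) = (2 * real (m * \<kappa>)) * sqrt r" by simp
    moreover have "sqrt r * sqrt r = r" by simp
    ultimately have "(2 * real (m * \<kappa>)) * sqrt r \<le> sqrt r * sqrt r" by linarith
    hence R: "2 * real (m * \<kappa>) \<le> sqrt r" using r0 by (simp only: mult_le_cancel_right_pos)
    have "m * \<kappa> mod 2 = t mod 2" using hyps unfolding cong_def by blast
    hence par: "even (m * \<kappa> + t)" by presburger
    show False
      by (rule coordinates_false[OF refl refl assms(9) q4 assms(4,11-13) R par _ _ _ *])
        (use hyps below in \<open>auto simp: s_def\<close>)
  qed
  ultimately show "\<not> (\<lambda>\<alpha>. real m * \<alpha>) ` totally_positive_integers K \<subseteq> sums_of_squares (ring_of_integers K)"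
    by blast
qed

end
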